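(* Let $n\ge d\ge 2$, $K\ge 0$, $\alpha_0,\dots,\alpha_K\in\mathbb{R}$, and let $X(t)$, $t$ in an interval $I\ni 0$, be a solution in $\mathcal{E}$ of polynomial dynamics $\dot X = N(P)X$, where $P = XX^\top$ and $N(P) = \sum_{k=0}^K\alpha_kP^k$. Suppose that $P(0)$ has simple nonzero spectrum: its nonzero eigenvalues satisfy $\lambda_1(0)>\lambda_2(0)>\dots>\lambda_d(0)>0$. Then the dynamics have trivial holonomy in the following concrete sense: (1) The generators $N(P(t_1))$ and $N(P(t_2))$ commute for all $t_1,t_2\in I$ (they share eigenvectors), so the sectional curvature along this trajectory in $\mathcal{B}$ vanishes. (2) Each eigenvalue $\lambda_\iota(t)$ ($1\le\iota\le d$) satisfies a one-dimensional autonomous ODE, so non-constant eigenvalue trajectories are monotone. In particular, the induced curve $P(t)$ cannot trace a nontrivial closed loop in $\mathcal{B}$ (if $P(t_0)=P(t_1)$ with $t_0\ne t_1$, then $P$ is constant).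
   Context: $\mathcal{E}$ is the open set of $X\in\mathbb{R}^{n\times d}$ of rank $d$, with rows $x_i^\top$, such that $0<x_i^\top x_j<1$ for all $i,j$; $\pi(X)=XX^\top$, $\mathcal{B}=\pi(\mathcal{E})\cong\mathcal{E}/O(d)$, where $O(d)$ acts by right multiplication. $\mathcal{B}$ carries the quotient metric making $\pi$ a Riemannian submersion from $\mathcal{E}$ with the Frobenius metric. $\lambda_1(t),\dots,\lambda_d(t)$ denote the nonzero eigenvalues of $P(t)=X(t)X(t)^\top$. For dynamics $\dot X = M(X)X$ with $M$ symmetric (here $M(X)=N(XX^\top)$), "the sectional curvature along the trajectory vanishes" means: for every point $X$ on the trajectory and all times $t_1,t_2$, whenever the vectors $d\pi_X(M(X(t_1))X)$ and $d\pi_X(M(X(t_2))X)$ are linearly independent, the sectional curvature of $\mathcal{B}$ at $\pi(X)$ of the plane they span is zero. *)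

theory Defs
  imports "HOL-Analysis.Analysis" "HOL-Computational_Algebra.Computational_Algebra"
begin

(* C^k on an open subset of a Euclidean space (k-fold iterated directional derivatives exist
   as Frechet derivatives and are continuous). *)
primrec Ck_on ::
  "nat \<Rightarrow> ('a::euclidean_space \<Rightarrow> 'b::real_normed_vector) \<Rightarrow> 'a set \<Rightarrow> bool" where
  "Ck_on 0 f S \<longleftrightarrow> continuous_on S f"
| "Ck_on (Suc k) f S \<longleftrightarrow> (\<forall>x\<in>S. f differentiable (at x)) \<and>
     (\<forall>v. Ck_on k (\<lambda>x. frechet_derivative f (at x) v) S)"

definition smooth_on :: "('a::euclidean_space \<Rightarrow> 'b::real_normed_vector) \<Rightarrow> 'a set \<Rightarrow> bool" where
  "smooth_on f S \<longleftrightarrow> (\<forall>k. Ck_on k f S)"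

(* Riemannian geometry of the base B = pr ` E of a submersion pr from an open subset E of a
   Euclidean space onto a submanifold B of another Euclidean space, B carrying the metric that
   makes pr a Riemannian submersion.  B is treated as a quotient manifold of E: a map F on B is
   smooth iff F o pr is smooth on E, and tangent vectors of B are images under the differential
   of pr.  The locale makes no assumptions; for the definitions to be meaningful, E must be open,
   the image of the differential and the length of horizontal lifts must not depend on the point
   chosen in a fibre, and B must be embedded.  This holds for an isometric group action such as
   that of O(d) below. *)
locale riemannian_quotient =
  fixes E :: "'a::euclidean_space set" and pr :: "'a \<Rightarrow> 'b::euclidean_space"
begin

definition base :: "'b set" where
  "base = pr ` E"

definition dpr :: "'a \<Rightarrow> 'a \<Rightarrow> 'b" where
  "dpr X = frechet_derivative pr (at X)"

definition tangent :: "'b \<Rightarrow> 'b set" where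
  "tangent p = {dpr X U | X U. X \<in> E \<and> pr X = p}"

definition horizontal :: "'a \<Rightarrow> 'a set" where
  "horizontal X = {U. dpr X U = 0}\<^sup>\<bottom>"

definition hlift :: "'a \<Rightarrow> 'b \<Rightarrow> 'a" where
  "hlift X v = (THE U. U \<in> horizontal X \<and> dpr X U = v)"

definition metric :: "'b \<Rightarrow> 'b \<Rightarrow> 'b \<Rightarrow> real" where
  "metric p v w = (THE r. \<forall>X\<in>E. pr X = p \<longrightarrow> r = inner (hlift X v) (hlift X w))"

(* The derivative of a map F on the base at p along a tangent vector v, computed along the
   curves s |-> pr (X + s U) with velocity v at p. *)
definition deriv_along :: "('b \<Rightarrow> 'c::real_normed_vector) \<Rightarrow> 'b \<Rightarrow> 'b \<Rightarrow> 'c" where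
  "deriv_along F p v = (THE D. \<forall>X\<in>E. \<forall>U. pr X = p \<and> dpr X U = v \<longrightarrow>
     ((\<lambda>s. F (pr (X + s *\<^sub>R U))) has_vector_derivative D) (at 0))"

definition vector_fields :: "('b \<Rightarrow> 'b) set" where
  "vector_fields = {V. smooth_on (V \<circ> pr) E \<and> (\<forall>p\<in>base. V p \<in> tangent p)}"

(* The Lie bracket, computed in the ambient Euclidean space of the base. *)
definition bracket :: "('b \<Rightarrow> 'b) \<Rightarrow> ('b \<Rightarrow> 'b) \<Rightarrow> 'b \<Rightarrow> 'b" where
  "bracket V W p = deriv_along W p (V p) - deriv_along V p (W p)"

definition koszul :: "('b \<Rightarrow> 'b) \<Rightarrow> ('b \<Rightarrow> 'b) \<Rightarrow> ('b \<Rightarrow> 'b) \<Rightarrow> 'b \<Rightarrow> real" where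
  "koszul V W Z p =
       deriv_along (\<lambda>q. metric q (W q) (Z q)) p (V p)
     + deriv_along (\<lambda>q. metric q (V q) (Z q)) p (W p)
     - deriv_along (\<lambda>q. metric q (V q) (W q)) p (Z p)
     + metric p (bracket V W p) (Z p)
     - metric p (bracket V Z p) (W p)
     - metric p (bracket W Z p) (V p)"

(* The Levi-Civita connection, determined by the Koszul formula. *)
definition nabla :: "('b \<Rightarrow> 'b) \<Rightarrow> ('b \<Rightarrow> 'b) \<Rightarrow> 'b \<Rightarrow> 'b" where
  "nabla V W p = (THE z. z \<in> tangent p \<and>
     (\<forall>Z\<in>vector_fields. 2 * metric p z (Z p) = koszul V W Z p))"

definition curvature :: "('b \<Rightarrow> 'b) \<Rightarrow> ('b \<Rightarrow> 'b) \<Rightarrow> ('b \<Rightarrow> 'b) \<Rightarrow> 'b \<Rightarrow> 'b" where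
  "curvature V W Z p =
     nabla V (nabla W Z) p - nabla W (nabla V Z) p - nabla (bracket V W) Z p"

(* The sectional curvature at p of the tangent plane \<sigma>. *)
definition sectional_curvature :: "'b \<Rightarrow> 'b set \<Rightarrow> real" where
  "sectional_curvature p \<sigma> = (THE \<kappa>. \<forall>V\<in>vector_fields. \<forall>W\<in>vector_fields.
     V p \<noteq> W p \<and> independent {V p, W p} \<and> span {V p, W p} = \<sigma> \<longrightarrow>
     \<kappa> = metric p (curvature V W W p) (V p) /
         (metric p (V p) (V p) * metric p (W p) (W p) - (metric p (V p) (W p))\<^sup>2))"

end

(* real^'d^'n is the space of n x d matrices; its inner product is the Frobenius one. *)
definition gram :: "real^'d^'n \<Rightarrow> real^'n^'n" where
  "gram X = X ** transpose X"

definition gram_domain :: "(real^'d^'n) set" where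
  "gram_domain = {X. rank X = CARD('d) \<and>
     (\<forall>i j. 0 < inner (row i X) (row j X) \<and> inner (row i X) (row j X) < 1)}"

(* The power operation of type vec acts componentwise, so matrix powers are defined here. *)
primrec matrix_pow :: "real^'n^'n \<Rightarrow> nat \<Rightarrow> real^'n^'n" where
  "matrix_pow A 0 = mat 1"
| "matrix_pow A (Suc k) = A ** matrix_pow A k"

definition poly_generator :: "nat \<Rightarrow> (nat \<Rightarrow> real) \<Rightarrow> real^'n^'n \<Rightarrow> real^'n^'n" where
  "poly_generator K \<alpha> P = (\<Sum>k\<le>K. \<alpha> k *\<^sub>R matrix_pow P k)"

definition charpoly :: "real^'n^'n \<Rightarrow> real poly" where
  "charpoly A = det (\<chi> i j. (if i = j then [:0, 1:] else 0) - [:A $ i $ j:])"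

(* nonzero_eigenvalue A i is the i-th largest nonzero eigenvalue of A, where i starts at 1 and
   eigenvalues are repeated according to multiplicity (for real symmetric A, all roots of the
   characteristic polynomial are real). *)
definition nonzero_eigenvalue :: "real^'n^'n \<Rightarrow> nat \<Rightarrow> real" where
  "nonzero_eigenvalue A \<iota> =
     rev (sorted_list_of_multiset (filter_mset (\<lambda>x. x \<noteq> 0) (proots (charpoly A)))) ! (\<iota> - 1)"

end

theory Submission
  imports Defs
begin

text \<open>
  The commutator \<open>[P(t), P(t\<^sub>0)]\<close> satisfies a linear differential inequality and vanishes at \<open>t\<^sub>0\<close>, hence
  all \<open>P(t)\<close> commute, and as the nonzero spectrum of \<open>P(0)\<close> is simple, an orthonormal eigenbasis of \<open>P(0)\<close>
  diagonalizes every \<open>P(t)\<close>. Its eigenvalues then solve the scalar equation \<open>\<mu>' = 2 \<mu> p(\<mu>)\<close>, where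
  \<open>p = \<Sum>\<^sub>k \<alpha>\<^sub>k x\<^sup>k\<close>; by uniqueness for this equation they keep their order and are constant or strictly
  monotone.

  For the curvature, a vector field on the base is replaced by its horizontal lift, and the Koszul formula
  shows that the Levi-Civita connection is the horizontal part of the flat derivative. A vector \<open>U\<close> at \<open>X\<close>
  is horizontal iff \<open>X\<^sup>T U\<close> is symmetric. For lifts \<open>A\<close>, \<open>B\<close> with \<open>A\<^sup>T B\<close> symmetric at a point, such as
  \<open>M X\<close> and \<open>N X\<close> with commuting symmetric \<open>M\<close>, \<open>N\<close>, the vertical terms of O'Neill's formula vanish at that
  point, and the curvature there is that of the flat total space.
\<close>

section \<open>Matrices\<close>

text \<open>Metric, derivative, connection and sectional curvature on the base are definite
  descriptions, ranging over all points of a fibre, all representatives of a tangent vector, or all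
  smooth fields. Each can be evaluated only once independence of these choices and existence of
  enough fields are shown. Independence rests on two facts: a fibre of \<open>gram\<close> is a
  single orbit of O(d), and \<open>F (gram X)\<close> has zero derivative in vertical directions.
  Existence is supplied by the linear fields \<open>q \<mapsto> S q + q S\<close>, whose lifts
  \<open>X \<mapsto> S X\<close> realize every horizontal vector.

  The covariant derivative of a field is differentiated again without being known to be smooth, so
  \<open>nabla_lift\<close> asks only for lifts differentiable at the point. Lifts of smooth fields
  are shown to be twice differentiable, which is what the symmetry of second derivatives requires.

  Only the nonzero eigenvalues of \<open>P(0)\<close> are simple. The kernel, of dimension n - d, is
  handled by a separate uniqueness argument: all \<open>P(t)\<close> annihilate it.\<close>

lemma matrix_scaleR_simps:
  fixes A :: "real^'m^'n" and B :: "real^'p^'m"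
  shows "(c *\<^sub>R A) ** B = c *\<^sub>R (A ** B)" "A ** (c *\<^sub>R B) = c *\<^sub>R (A ** B)"
  by (simp_all add: scalar_matrix_assoc matrix_scalar_ac)

lemma transpose_add: "transpose (A + B) = transpose A + transpose (B :: real^'m^'n)"
  and transpose_diff: "transpose (A - B) = transpose A - transpose B"
  and transpose_minus: "transpose (- A) = - transpose A"
  and transpose_zero: "transpose (0 :: real^'m^'n) = 0"
  by (simp_all add: transpose_def vec_eq_iff)

lemma matrix_add_rdistrib: "(A + B) ** C = A ** C + B ** (C :: real^'p^'m)"
  for A B :: "real^'m^'n"
  by (simp add: matrix_matrix_mult_def vec_eq_iff algebra_simps sum.distrib)

lemma bounded_bilinear_matrix_mult:
  "bounded_bilinear ((**) :: real^'m^'n \<Rightarrow> real^'p^'m \<Rightarrow> real^'p^'n)"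
  unfolding bilinear_conv_bounded_bilinear [symmetric] bilinear_def
  by (auto intro!: linearI simp: matrix_add_ldistrib matrix_add_rdistrib matrix_scaleR_simps)

lemmas matrix_minus_left = bounded_bilinear.minus_left [OF bounded_bilinear_matrix_mult]
  and matrix_minus_right = bounded_bilinear.minus_right [OF bounded_bilinear_matrix_mult]
  and matrix_diff_left = bounded_bilinear.diff_left [OF bounded_bilinear_matrix_mult]
  and matrix_diff_right = bounded_bilinear.diff_right [OF bounded_bilinear_matrix_mult]
  and matrix_zero_left = bounded_bilinear.zero_left [OF bounded_bilinear_matrix_mult]
  and matrix_zero_right = bounded_bilinear.zero_right [OF bounded_bilinear_matrix_mult]
  and matrix_sum_left = bounded_bilinear.sum_left [OF bounded_bilinear_matrix_mult]
  and matrix_sum_right = bounded_bilinear.sum_right [OF bounded_bilinear_matrix_mult]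

lemmas matrix_algebra = matrix_scaleR_simps matrix_add_ldistrib matrix_add_rdistrib
  matrix_minus_left matrix_minus_right matrix_diff_left matrix_diff_right
  matrix_zero_left matrix_zero_right matrix_transpose_mul transpose_add transpose_diff
  transpose_minus transpose_zero transpose_scalar matrix_mul_assoc

lemma bounded_linear_transpose: "bounded_linear (transpose :: real^'m^'n \<Rightarrow> real^'n^'m)"
  unfolding linear_conv_bounded_linear [symmetric]
  by (auto intro!: linearI simp: transpose_add transpose_scalar)

lemma inner_transpose: "inner (transpose A) (transpose B) = inner A (B :: real^'m^'n)"
  unfolding inner_vec_def transpose_def by (simp, rule sum.swap)

lemma inner_matrix_mult_right:
  fixes A :: "real^'m^'n" and B :: "real^'p^'m" and C :: "real^'p^'n"
  shows "inner (A ** B) C = inner A (C ** transpose B)"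
proof -
  have "inner (A ** B) C = (\<Sum>i\<in>UNIV. \<Sum>j\<in>UNIV. \<Sum>k\<in>UNIV. A$i$k * B$k$j * C$i$j)"
    by (simp add: inner_vec_def matrix_matrix_mult_def sum_distrib_right)
  also have "\<dots> = (\<Sum>i\<in>UNIV. \<Sum>k\<in>UNIV. \<Sum>j\<in>UNIV. A$i$k * B$k$j * C$i$j)"
    by (intro sum.cong refl sum.swap)
  also have "\<dots> = inner A (C ** transpose B)"
    by (simp add: inner_vec_def matrix_matrix_mult_def transpose_def sum_distrib_left mult_ac)
  finally show ?thesis .
qed

lemma inner_matrix_mult_left:
  fixes A :: "real^'m^'n" and B :: "real^'p^'m" and C :: "real^'p^'n"
  shows "inner (A ** B) C = inner B (transpose A ** C)"
  using inner_matrix_mult_right [of "transpose B" "transpose A" "transpose C"]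
  by (metis inner_transpose matrix_transpose_mul transpose_transpose)

section \<open>Symmetric and skew matrices, infinitesimal rotations\<close>

definition skew :: "real^'n^'n \<Rightarrow> bool" where
  "skew A \<longleftrightarrow> transpose A = - A"

definition symmetric_matrix :: "real^'n^'n \<Rightarrow> bool" where
  "symmetric_matrix A \<longleftrightarrow> transpose A = A"

text \<open>Transposition is an isometry of the Frobenius product with the symmetric and the skew
  matrices as eigenspaces for 1 and -1. The converse tests \<open>B\<close> against its own skew
  part (doubled).\<close>

lemma symmetric_iff_orthogonal_skew:
  "symmetric_matrix (B :: real^'n^'n) \<longleftrightarrow> (\<forall>A. skew A \<longrightarrow> inner A B = 0)"
proof
  assume B: "symmetric_matrix B"
  show "\<forall>A. skew A \<longrightarrow> inner A B = 0"
  proof (intro allI impI)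
    fix A :: "real^'n^'n" assume "skew A"
    then have "inner A B = - inner A B"
      using inner_transpose [of A B] B by (simp add: skew_def symmetric_matrix_def)
    then show "inner A B = 0" by simp
  qed
next
  assume *: "\<forall>A. skew A \<longrightarrow> inner A B = 0"
  let ?A = "B - transpose B"
  have "skew ?A" by (simp add: skew_def transpose_diff)
  with * have 0: "inner ?A B = 0" by blast
  moreover have "inner ?A (transpose B) = - inner ?A B"
    using inner_transpose [of ?A B] \<open>skew ?A\<close> unfolding skew_def
    by (metis inner_minus_left minus_minus)
  ultimately have "inner ?A ?A = 0" by (simp add: inner_diff_right)
  then show "symmetric_matrix B" by (simp add: symmetric_matrix_def)
qed

text \<open>For \<open>J\<^sup>3 = - J\<close> this matrix is \<open>exp (s J)\<close>.\<close>

lemma rotation_curve_orthogonal: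
  fixes J :: "real^'n^'n"
  assumes J: "skew J" "J ** J ** J = - J"
  shows "orthogonal_matrix (mat 1 + sin s *\<^sub>R J + (1 - cos s) *\<^sub>R (J ** J))" (is "orthogonal_matrix ?R")
proof -
  have t: "transpose ?R = mat 1 - sin s *\<^sub>R J + (1 - cos s) *\<^sub>R (J ** J)"
    using J(1) by (simp add: skew_def matrix_algebra)
  have J4: "J ** J ** J ** J = - (J ** J)" by (simp add: J(2) matrix_algebra)
  have "transpose ?R ** ?R = mat 1 + (2 * (1 - cos s) - (sin s)\<^sup>2 - (1 - cos s)\<^sup>2) *\<^sub>R (J ** J)"
    unfolding t
    by (simp add: matrix_algebra J J4 algebra_simps power2_eq_square)
      (simp add: scaleR_add_left [symmetric] power2_eq_square [symmetric])
  also have "2 * (1 - cos s) - (sin s)\<^sup>2 - (1 - cos s)\<^sup>2 = 0"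
    by (simp add: sin_squared_eq) (simp add: power2_eq_square algebra_simps)
  finally show ?thesis by (simp add: orthogonal_matrix)
qed

text \<open>The difference \<open>E_ij - E_ji\<close> of matrix units, the infinitesimal rotation of
  one coordinate plane. These matrices span the skew ones, and their exponentials have the closed
  form above because \<open>J ** J ** J = - J\<close>.\<close>

definition plane_rotation :: "'n \<Rightarrow> 'n \<Rightarrow> real^'n^'n" where
  "plane_rotation i j = (\<chi> a b. axis i 1 $ a * axis j 1 $ b - axis j 1 $ a * axis i 1 $ b)"

lemma plane_rotation_vector:
  "plane_rotation i j *v x = x $ j *\<^sub>R axis i 1 - x $ i *\<^sub>R axis j 1"
proof -
  have ax: "(\<Sum>b\<in>UNIV. c * axis k 1 $ b * x $ b) = c * x $ k" for k c
    using inner_axis' [of k 1 x] by (simp add: inner_vec_def mult.assoc sum_distrib_left [symmetric])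
  show ?thesis
    unfolding vec_eq_iff
    by (simp add: plane_rotation_def matrix_vector_mult_def left_diff_distrib sum_subtractf ax)
qed

lemma skew_plane_rotation: "skew (plane_rotation i j)"
  by (simp add: skew_def plane_rotation_def transpose_def vec_eq_iff)

lemma matrix_vector_minus_left: "(- A) *v x = - (A *v (x :: real^'m))" for A :: "real^'m^'n"
  using matrix_vector_mult_diff_rdistrib [of 0 A x] by simp

lemma plane_rotation_cube:
  assumes "i \<noteq> j"
  shows "plane_rotation i j ** plane_rotation i j ** plane_rotation i j = - plane_rotation i j"
  unfolding matrix_eq using assms
  by (auto simp: plane_rotation_vector matrix_vector_mul_assoc [symmetric] vec_eq_iff axis_def
      matrix_vector_minus_left)

text \<open>The sum runs over ordered pairs, so every plane occurs twice, with equal contributions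
  because both factors change sign under exchange of \<open>i\<close> and \<open>j\<close>; hence
  the factor 1/2.\<close>

lemma skew_eq_sum_plane_rotation:
  fixes A :: "real^'n^'n"
  assumes "skew A"
  shows "A = (1/2) *\<^sub>R (\<Sum>i\<in>UNIV. \<Sum>j\<in>UNIV. (A $ i $ j) *\<^sub>R plane_rotation i j)"
proof -
  have A: "A $ b $ a = - A $ a $ b" for a b
    using arg_cong [OF assms [unfolded skew_def], of "\<lambda>M. M $ a $ b"] by (simp add: transpose_def)
  have ax: "(\<Sum>b\<in>UNIV. f b * axis b 1 $ k) = f k" for k :: 'n and f :: "'n \<Rightarrow> real"
    by (simp add: axis_def if_distrib cong: if_cong)
  have "(\<Sum>i\<in>UNIV. \<Sum>j\<in>UNIV. (A $ i $ j) *\<^sub>R plane_rotation i j) $ a $ b = 2 * A $ a $ b" for a b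
  proof -
    have "(\<Sum>i\<in>UNIV. \<Sum>j\<in>UNIV. (A $ i $ j) *\<^sub>R plane_rotation i j) $ a $ b
      = (\<Sum>i\<in>UNIV. (\<Sum>j\<in>UNIV. A $ i $ j * axis j 1 $ b) * axis i 1 $ a)
        - (\<Sum>i\<in>UNIV. (\<Sum>j\<in>UNIV. A $ i $ j * axis j 1 $ a) * axis i 1 $ b)"
      by (simp add: plane_rotation_def right_diff_distrib sum_subtractf sum_distrib_right sum_distrib_left mult_ac)
    also have "\<dots> = A $ a $ b - A $ b $ a"
      by (simp only: ax)
    finally show ?thesis using A [of a b] by simp
  qed
  then show ?thesis by (simp add: vec_eq_iff)
qed

lemma left_inverse_inj:
  fixes X :: "real^'d^'n" and L :: "real^'n^'d"
  assumes L: "L ** X = mat 1" and "X ** A = X ** (B :: real^'p^'d)"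
  shows "A = B"
  by (metis L assms(2) matrix_mul_assoc matrix_mul_lid)

lemma right_inverse_inj:
  fixes X :: "real^'d^'n" and L :: "real^'n^'d"
  assumes L: "L ** X = mat 1" and "A ** transpose X = B ** transpose X"
  shows "A = (B :: real^'d^'p)"
  using left_inverse_inj [OF L, of "transpose A" "transpose B"] assms(2)
  by (metis matrix_transpose_mul transpose_iff transpose_transpose)

section \<open>Second derivatives\<close>

abbreviation (input) FD :: "('a::real_normed_vector \<Rightarrow> 'b::real_normed_vector) \<Rightarrow> 'a \<Rightarrow> 'a \<Rightarrow> 'b" where
  "FD f x \<equiv> frechet_derivative f (at x)"

lemma FD_works: "f differentiable (at x) \<Longrightarrow> (f has_derivative FD f x) (at x)"
  by (simp add: frechet_derivative_works)

lemma FD_eq: "(f has_derivative f') (at x) \<Longrightarrow> FD f x = f'"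
  by (rule frechet_derivative_at [symmetric])

lemma FD_linear: "f differentiable (at x) \<Longrightarrow> linear (FD f x)"
  by (rule linear_frechet_derivative)

text \<open>The regularity that the curvature consumes, as each lift is differentiated twice. Since
  the second derivative need not be continuous, the property passes easily to solutions of linear
  systems.\<close>

definition twice_differentiable_on ::
    "('a::real_normed_vector \<Rightarrow> 'b::real_normed_vector) \<Rightarrow> 'a set \<Rightarrow> bool" where
  "twice_differentiable_on f S \<longleftrightarrow> (\<forall>x\<in>S. f differentiable (at x)) \<and>
     (\<forall>v. \<forall>x\<in>S. (\<lambda>y. FD f y v) differentiable (at x))"

lemma twice_differentiable_onD:
  assumes "twice_differentiable_on f S" "x \<in> S"
  shows "f differentiable (at x)" "(\<lambda>y. FD f y v) differentiable (at x)"
  using assms by (auto simp: twice_differentiable_on_def)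

lemma smooth_on_imp_twice_differentiable_on:
  assumes "smooth_on f S" shows "twice_differentiable_on f S"
proof -
  have "Ck_on (Suc (Suc 0)) f S" using assms by (simp only: smooth_on_def)
  then show ?thesis by (simp add: twice_differentiable_on_def)
qed

lemma DERIV_along_line:
  fixes f :: "'a::real_normed_vector \<Rightarrow> real"
  assumes "f differentiable (at (a + s *\<^sub>R u))"
  shows "((\<lambda>s. f (a + s *\<^sub>R u)) has_real_derivative FD f (a + s *\<^sub>R u) u) (at s)"
proof -
  have "((\<lambda>s. a + s *\<^sub>R u) has_derivative (\<lambda>r. r *\<^sub>R u)) (at s)"
    by (auto intro!: derivative_eq_intros)
  from has_derivative_compose [OF this FD_works [OF assms]]
  have "((\<lambda>s. f (a + s *\<^sub>R u)) has_derivative (\<lambda>r. FD f (a + s *\<^sub>R u) (r *\<^sub>R u))) (at s)" .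
  moreover have "(\<lambda>r. FD f (a + s *\<^sub>R u) (r *\<^sub>R u)) = (*) (FD f (a + s *\<^sub>R u) u)"
    using linear_cmul [OF FD_linear [OF assms]] by (simp add: fun_eq_iff mult.commute)
  ultimately show ?thesis by (simp add: has_field_derivative_def)
qed

text \<open>Apply the mean value theorem along \<open>u\<close> to the difference of
  \<open>f\<close> on the segments starting at \<open>x + h v\<close> and at \<open>x\<close>. It
  leaves a difference of two values of \<open>FD f _ u\<close> near \<open>x\<close>, and each is
  expanded to first order at \<open>x\<close>.\<close>

lemma second_difference_tendsto:
  fixes f :: "'a::real_normed_vector \<Rightarrow> real"
  assumes S: "open S" "x \<in> S" and f: "\<And>y. y \<in> S \<Longrightarrow> f differentiable (at y)"
    and G: "((\<lambda>y. FD f y u) has_derivative G) (at x)"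
  shows "((\<lambda>h. (f (x + h *\<^sub>R u + h *\<^sub>R v) - f (x + h *\<^sub>R u) - f (x + h *\<^sub>R v) + f x) / h\<^sup>2) \<longlongrightarrow> G v)
           (at_right 0)"
proof (rule tendstoI)
  fix e :: real assume e: "e > 0"
  define c where "c = norm u + norm v"
  \<comment> \<open>Two remainders of size at most \<open>e' * (h * c)\<close>, divided by
    \<open>h\<close>, add up to at most \<open>2 * e' * c < e\<close>. The \<open>+ 1\<close> covers
    \<open>u = v = 0\<close>.\<close>
  define e' where "e' = e / (4 * (c + 1))"
  have c: "c \<ge> 0" and e': "e' > 0" using e by (simp_all add: c_def e'_def add_nonneg_pos)
  have linG: "linear G" using G has_derivative_linear by blast
  obtain d where d: "d > 0" "\<And>y. norm (y - x) < d \<Longrightarrow>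
      norm (FD f y u - FD f x u - G (y - x)) \<le> e' * norm (y - x)"
    using G e' unfolding has_derivative_at_alt by blast
  obtain r where r: "r > 0" "ball x r \<subseteq> S" using S openE by blast
  define \<delta> where "\<delta> = min d r / (c + 1)"
  have \<delta>: "\<delta> > 0" using d(1) r(1) c by (simp add: \<delta>_def)
  show "eventually (\<lambda>h. dist ((f (x + h *\<^sub>R u + h *\<^sub>R v) - f (x + h *\<^sub>R u) - f (x + h *\<^sub>R v) + f x) / h\<^sup>2) (G v) < e)
          (at_right 0)"
    unfolding eventually_at_right_field
  proof (intro exI conjI allI impI)
    show "0 < \<delta>" by fact
    fix h :: real assume h: "0 < h" "h < \<delta>"
    have small: "norm (s *\<^sub>R u + q *\<^sub>R v) \<le> h * c \<and> h * c < d \<and> h * c < r"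
      if "0 \<le> s" "s \<le> h" "0 \<le> q" "q \<le> h" for s q
    proof -
      have "norm (s *\<^sub>R u + q *\<^sub>R v) \<le> s * norm u + q * norm v"
        using norm_triangle_ineq [of "s *\<^sub>R u" "q *\<^sub>R v"] that by simp
      also have "\<dots> \<le> h * norm u + h * norm v"
        using that by (intro add_mono mult_right_mono) auto
      finally have 1: "norm (s *\<^sub>R u + q *\<^sub>R v) \<le> h * c" by (simp add: c_def algebra_simps)
      have "h * c \<le> h * (c + 1)" using h by simp
      also have "h * (c + 1) < \<delta> * (c + 1)" using h c by simp
      also have "\<dots> = min d r" using c by (simp add: \<delta>_def)
      finally show ?thesis using 1 by simp
    qed
    have inS: "x + (s *\<^sub>R u + q *\<^sub>R v) \<in> S" if "0 \<le> s" "s \<le> h" "0 \<le> q" "q \<le> h" for s q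
    proof -
      have "dist (x + (s *\<^sub>R u + q *\<^sub>R v)) x < r" using small [OF that] by (simp add: dist_norm)
      then show ?thesis using r(2) by (auto simp: dist_commute)
    qed
    let ?\<phi> = "\<lambda>s. f ((x + h *\<^sub>R v) + s *\<^sub>R u) - f (x + s *\<^sub>R u)"
    have "\<exists>\<xi>>0. \<xi> < h \<and> ?\<phi> h - ?\<phi> 0 = (h - 0) * (FD f ((x + h *\<^sub>R v) + \<xi> *\<^sub>R u) u - FD f (x + \<xi> *\<^sub>R u) u)"
    proof (rule MVT2)
      fix s assume s: "0 \<le> s" "s \<le> h"
      have eq: "x + (s *\<^sub>R u + h *\<^sub>R v) = (x + h *\<^sub>R v) + s *\<^sub>R u" by simp
      have "f differentiable (at ((x + h *\<^sub>R v) + s *\<^sub>R u))" "f differentiable (at (x + s *\<^sub>R u))"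
        using f [OF inS [of s h], unfolded eq] f [OF inS [of s 0]] s h by simp_all
      then show "(?\<phi> has_real_derivative FD f ((x + h *\<^sub>R v) + s *\<^sub>R u) u - FD f (x + s *\<^sub>R u) u) (at s)"
        by (intro derivative_intros DERIV_along_line)
    qed (use h in auto)
    then obtain \<xi> where \<xi>: "0 < \<xi>" "\<xi> < h"
      "?\<phi> h - ?\<phi> 0 = h * (FD f (x + (\<xi> *\<^sub>R u + h *\<^sub>R v)) u - FD f (x + \<xi> *\<^sub>R u) u)"
      by (auto simp: add_ac)
    let ?r1 = "FD f (x + (\<xi> *\<^sub>R u + h *\<^sub>R v)) u - FD f x u - G (\<xi> *\<^sub>R u + h *\<^sub>R v)"
    let ?r2 = "FD f (x + \<xi> *\<^sub>R u) u - FD f x u - G (\<xi> *\<^sub>R u)"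
    have s1: "norm (\<xi> *\<^sub>R u + h *\<^sub>R v) \<le> h * c" "h * c < d" using small [of \<xi> h] \<xi> h by auto
    have s2: "norm (\<xi> *\<^sub>R u) \<le> h * c" using small [of \<xi> 0] \<xi> h by auto
    have "norm ?r1 \<le> e' * norm (\<xi> *\<^sub>R u + h *\<^sub>R v)"
      using d(2) [of "x + (\<xi> *\<^sub>R u + h *\<^sub>R v)"] s1 by simp
    also have "\<dots> \<le> e' * (h * c)" using s1 e' by simp
    finally have r1: "\<bar>?r1\<bar> \<le> e' * (h * c)" by simp
    have "norm ?r2 \<le> e' * norm (\<xi> *\<^sub>R u)"
      using d(2) [of "x + \<xi> *\<^sub>R u"] s1 s2 by simp
    also have "\<dots> \<le> e' * (h * c)" using s2 e' by (intro mult_left_mono) auto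
    finally have r2: "\<bar>?r2\<bar> \<le> e' * (h * c)" by simp
    have "G (\<xi> *\<^sub>R u + h *\<^sub>R v) = G (\<xi> *\<^sub>R u) + h * G v"
      by (simp add: linear_add [OF linG] linear_cmul [OF linG])
    then have "?\<phi> h - ?\<phi> 0 = h * (h * G v + (?r1 - ?r2))"
      unfolding \<xi>(3) by (simp add: algebra_simps)
    moreover define R where "R = ?r1 - ?r2"
    moreover have "?\<phi> h - ?\<phi> 0 = f (x + h *\<^sub>R u + h *\<^sub>R v) - f (x + h *\<^sub>R u) - f (x + h *\<^sub>R v) + f x"
      by (simp add: add_ac)
    ultimately have "f (x + h *\<^sub>R u + h *\<^sub>R v) - f (x + h *\<^sub>R u) - f (x + h *\<^sub>R v) + f x = h * (h * G v + R)"
      by simp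
    moreover have "h * (h * G v + R) / h\<^sup>2 - G v = R / h"
      using h by (simp add: field_simps power2_eq_square)
    ultimately have "(f (x + h *\<^sub>R u + h *\<^sub>R v) - f (x + h *\<^sub>R u) - f (x + h *\<^sub>R v) + f x) / h\<^sup>2 - G v
       = (?r1 - ?r2) / h"
      unfolding R_def by metis
    then have "\<bar>(f (x + h *\<^sub>R u + h *\<^sub>R v) - f (x + h *\<^sub>R u) - f (x + h *\<^sub>R v) + f x) / h\<^sup>2 - G v\<bar>
       = \<bar>?r1 - ?r2\<bar> / h" using h by simp
    also have "\<dots> \<le> (2 * (e' * (h * c))) / h"
      using r1 r2 h by (intro divide_right_mono) auto
    also have "\<dots> = e * (c / (2 * (c + 1)))"
    proof -
      have "2 * (e / (4 * q) * (h * c)) / h = e * (c / (2 * q))" if "q > 0" for q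
        using h that by (simp add: field_simps)
      from this [of "c + 1"] show ?thesis using c by (simp add: e'_def)
    qed
    also have "\<dots> < e * 1"
      using e c by (intro mult_strict_left_mono) (auto simp: divide_simps)
    finally show "dist ((f (x + h *\<^sub>R u + h *\<^sub>R v) - f (x + h *\<^sub>R u) - f (x + h *\<^sub>R v) + f x) / h\<^sup>2) (G v) < e"
      by (simp add: dist_real_def)
  qed
qed

text \<open>The second difference quotient is symmetric in \<open>u\<close> and \<open>v\<close>, so
  its two limits agree. Pairing with an arbitrary vector \<open>c\<close> reduces to real-valued
  functions, for which the mean value theorem is available.\<close>

lemma symmetric_second_derivative:
  fixes f :: "'a::real_normed_vector \<Rightarrow> 'b::real_inner"
  assumes S: "open S" "x \<in> S" and f: "twice_differentiable_on f S"
  shows "FD (\<lambda>y. FD f y u) x v = FD (\<lambda>y. FD f y v) x u"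
proof -
  have "inner (FD (\<lambda>y. FD f y u) x v) c = inner (FD (\<lambda>y. FD f y v) x u) c" for c
  proof -
    let ?g = "\<lambda>y. inner (f y) c"
    have g: "(?g has_derivative (\<lambda>h. inner (FD f y h) c)) (at y)" if "y \<in> S" for y
      using FD_works [OF twice_differentiable_onD(1) [OF f that]]
      by (rule has_derivative_inner_left)
    have dg: "?g differentiable (at y)" if "y \<in> S" for y
      using g [OF that] by (auto simp: differentiable_def)
    have G: "((\<lambda>y. FD ?g y w) has_derivative (\<lambda>h. inner (FD (\<lambda>y. FD f y w) x h) c)) (at x)" for w
    proof (rule has_derivative_transform_within_open [OF _ S])
      show "((\<lambda>y. inner (FD f y w) c) has_derivative (\<lambda>h. inner (FD (\<lambda>y. FD f y w) x h) c)) (at x)"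
        by (intro has_derivative_inner_left FD_works twice_differentiable_onD(2) [OF f S(2)])
    qed (simp add: FD_eq [OF g])
    have eq: "((\<lambda>h. (?g (x + h *\<^sub>R u + h *\<^sub>R v) - ?g (x + h *\<^sub>R u) - ?g (x + h *\<^sub>R v) + ?g x) / h\<^sup>2)
      = (\<lambda>h. (?g (x + h *\<^sub>R v + h *\<^sub>R u) - ?g (x + h *\<^sub>R v) - ?g (x + h *\<^sub>R u) + ?g x) / h\<^sup>2))"
      by (auto simp: fun_eq_iff algebra_simps)
    show ?thesis
      by (rule tendsto_unique [OF _ second_difference_tendsto [OF S dg G, of u v]
            second_difference_tendsto [OF S dg G, of v u, folded eq]]) auto
  qed
  then show ?thesis by (metis inner_commute vector_eq_ldot)
qed

text \<open>Differentiability of \<open>FD f y v\<close> is given for fixed \<open>v\<close> only,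
  so the moving direction \<open>u y\<close> is expanded in the basis and the product rule applied
  to each coordinate.\<close>

lemma has_derivative_FD_apply:
  fixes f :: "'a::euclidean_space \<Rightarrow> 'b::real_normed_vector"
  assumes S: "open S" "x \<in> S" and f: "twice_differentiable_on f S" and u: "(u has_derivative u') (at x)"
  shows "((\<lambda>y. FD f y (u y)) has_derivative (\<lambda>h. FD (\<lambda>y. FD f y (u x)) x h + FD f x (u' h))) (at x)"
proof -
  have exp: "FD f y w = (\<Sum>b\<in>Basis. inner w b *\<^sub>R FD f y b)" if "y \<in> S" for y w
    using linear_sum [OF FD_linear [OF twice_differentiable_onD(1) [OF f that]],
        of "\<lambda>b. inner w b *\<^sub>R b" Basis]
      linear_cmul [OF FD_linear [OF twice_differentiable_onD(1) [OF f that]]]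
    by (simp add: euclidean_representation)
  have D: "((\<lambda>y. FD f y b) has_derivative FD (\<lambda>y. FD f y b) x) (at x)" for b
    by (intro FD_works twice_differentiable_onD(2) [OF f S(2)])
  have e1: "FD (\<lambda>y. FD f y w) x = (\<lambda>h. \<Sum>b\<in>Basis. inner w b *\<^sub>R FD (\<lambda>y. FD f y b) x h)" for w
  proof (rule FD_eq, rule has_derivative_transform_within_open [OF _ S])
    show "((\<lambda>y. \<Sum>b\<in>Basis. inner w b *\<^sub>R FD f y b) has_derivative
        (\<lambda>h. \<Sum>b\<in>Basis. inner w b *\<^sub>R FD (\<lambda>y. FD f y b) x h)) (at x)"
      by (intro has_derivative_sum has_derivative_scaleR_right D)
  qed (simp add: exp [symmetric])
  show ?thesis
  proof (rule has_derivative_transform_within_open [OF _ S])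
    have "((\<lambda>y. \<Sum>b\<in>Basis. inner (u y) b *\<^sub>R FD f y b) has_derivative
       (\<lambda>h. \<Sum>b\<in>Basis. inner (u x) b *\<^sub>R FD (\<lambda>y. FD f y b) x h + inner (u' h) b *\<^sub>R FD f x b)) (at x)"
      by (intro has_derivative_sum has_derivative_scaleR has_derivative_inner_left D u)
    moreover have "FD f x (u' h) = (\<Sum>b\<in>Basis. inner (u' h) b *\<^sub>R FD f x b)" for h
      by (rule exp [OF S(2)])
    then have "(\<lambda>h. \<Sum>b\<in>Basis. inner (u x) b *\<^sub>R FD (\<lambda>y. FD f y b) x h + inner (u' h) b *\<^sub>R FD f x b)
       = (\<lambda>h. FD (\<lambda>y. FD f y (u x)) x h + FD f x (u' h))"
      by (simp only: e1 [of "u x"] sum.distrib)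
    ultimately show "((\<lambda>y. \<Sum>b\<in>Basis. inner (u y) b *\<^sub>R FD f y b) has_derivative
       (\<lambda>h. FD (\<lambda>y. FD f y (u x)) x h + FD f x (u' h))) (at x)" by simp
  qed (simp add: exp [symmetric])
qed

section \<open>Differentiable families of linear systems\<close>

text \<open>At a zero of \<open>a\<close> the product rule asks only continuity of \<open>b\<close>:
  in \<open>\<beta> (a z) (b z - b x)\<close> the first factor is O(|z - x|) and the second tends to
  0. This breaks a circle in the next lemma, where \<open>b\<close> is the solution whose
  differentiability is to be shown.\<close>

lemma has_derivative_bilinear_zero:
  fixes \<beta> :: "'m::real_normed_vector \<Rightarrow> 'b::real_normed_vector \<Rightarrow> 'c::real_normed_vector"
    and a :: "'a::real_normed_vector \<Rightarrow> 'm"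
  assumes \<beta>: "bounded_bilinear \<beta>" and a: "(a has_derivative a') (at x)" "a x = 0"
    and b: "isCont b x"
  shows "((\<lambda>z. \<beta> (a z) (b z)) has_derivative (\<lambda>h. \<beta> (a' h) (b x))) (at x)"
proof -
  interpret bounded_bilinear \<beta> by fact
  obtain K where K: "K > 0" "\<And>p q. norm (\<beta> p q) \<le> norm p * norm q * K" using pos_bounded by blast
  obtain B where B: "B > 0" "\<And>h. norm (a' h) \<le> norm h * B"
    using a(1) bounded_linear.pos_bounded has_derivative_bounded_linear by blast
  have "((\<lambda>z. \<beta> (a z) (b z - b x)) has_derivative (\<lambda>h. 0)) (at x)"
    unfolding has_derivative_at_alt
  proof (intro conjI allI impI)
    fix e :: real assume e: "e > 0"
    \<comment> \<open>\<open>B + 1\<close> bounds the growth of \<open>a\<close> near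
      \<open>x\<close>: \<open>B\<close> comes from \<open>a'\<close>, 1 from the linearization
      error.\<close>
    define e' where "e' = e / ((B + 1) * K)"
    have e': "e' > 0" using e B K by (simp add: e'_def)
    obtain d1 where d1: "d1 > 0" "\<And>z. norm (z - x) < d1 \<Longrightarrow> norm (a z - a x - a' (z - x)) \<le> 1 * norm (z - x)"
      using a(1) zero_less_one unfolding has_derivative_at_alt by blast
    obtain d2 where d2: "d2 > 0" "\<And>z. dist z x < d2 \<Longrightarrow> dist (b z) (b x) < e'"
      using b e' unfolding continuous_at_eps_delta by blast
    show "\<exists>d>0. \<forall>y. norm (y - x) < d \<longrightarrow>
        norm (\<beta> (a y) (b y - b x) - \<beta> (a x) (b x - b x) - 0) \<le> e * norm (y - x)"
    proof (intro exI conjI allI impI)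
      show "0 < min d1 d2" using d1 d2 by simp
      fix y assume y: "norm (y - x) < min d1 d2"
      have "norm (a y) \<le> norm (a y - a x - a' (y - x)) + norm (a' (y - x))"
        using norm_triangle_ineq [of "a y - a x - a' (y - x)" "a' (y - x)"] a(2) by simp
      also have "\<dots> \<le> (B + 1) * norm (y - x)"
        using d1(2) [of y] B(2) [of "y - x"] y by (simp add: algebra_simps)
      finally have 1: "norm (a y) \<le> (B + 1) * norm (y - x)" .
      have 2: "norm (b y - b x) \<le> e'" using d2(2) [of y] y by (simp add: dist_norm)
      have "norm (\<beta> (a y) (b y - b x)) \<le> norm (a y) * norm (b y - b x) * K" by (rule K)
      also have "\<dots> \<le> ((B + 1) * norm (y - x)) * e' * K"
        using 1 2 K(1) B(1) e' by (intro mult_right_mono mult_mono) auto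
      also have "\<dots> = e * norm (y - x)" using B(1) K(1) by (simp add: e'_def)
      finally show "norm (\<beta> (a y) (b y - b x) - \<beta> (a x) (b x - b x) - 0) \<le> e * norm (y - x)"
        by (simp add: zero_right)
    qed
  qed simp
  moreover have "((\<lambda>z. \<beta> (a z) (b x)) has_derivative (\<lambda>h. \<beta> (a' h) (b x))) (at x)"
    using bounded_linear.has_derivative [OF bounded_linear_left a(1)] .
  ultimately have "((\<lambda>z. \<beta> (a z) (b x) + \<beta> (a z) (b z - b x)) has_derivative (\<lambda>h. \<beta> (a' h) (b x) + 0)) (at x)"
    by (intro has_derivative_add)
  then show ?thesis by (simp add: diff_right)
qed

text \<open>Subtracting the equations at \<open>z\<close> and \<open>x\<close> gives
  \<open>key\<close>. The lower bound \<open>m\<close> for the injective operator at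
  \<open>x\<close> first yields continuity of \<open>y\<close>; then the right side of
  \<open>key\<close> is differentiable by the preceding lemma, and the left inverse \<open>T\<close>
  turns it into \<open>y z - y x\<close>.\<close>

lemma differentiable_linear_system:
  fixes \<beta> :: "'m::real_normed_vector \<Rightarrow> 'b::euclidean_space \<Rightarrow> 'c::euclidean_space"
    and g :: "'a::real_normed_vector \<Rightarrow> 'm"
  assumes \<beta>: "bounded_bilinear \<beta>" and inj: "inj (\<beta> (g x))"
    and g: "g differentiable (at x)" and c: "c differentiable (at x)"
    and S: "open S" "x \<in> S" and sol: "\<And>z. z \<in> S \<Longrightarrow> \<beta> (g z) (y z) = c z"
  shows "y differentiable (at x)"
proof -
  interpret bounded_bilinear \<beta> by fact
  have lin: "linear (\<beta> (g x))" using bounded_linear_right bounded_linear.linear by blast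
  obtain K where K: "K > 0" "\<And>p q. norm (\<beta> p q) \<le> norm p * norm q * K" using pos_bounded by blast
  obtain m where m: "m > 0" "\<And>w. m * norm w \<le> norm (\<beta> (g x) w)"
    using linear_inj_bounded_below_pos [OF lin inj] by metis
  obtain T where T: "linear T" "T \<circ> \<beta> (g x) = id"
    using linear_injective_left_inverse [OF lin inj] by blast
  have key: "\<beta> (g x) (y z - y x) = (c z - c x) - \<beta> (g z - g x) (y z)" if "z \<in> S" for z
    using sol [OF that] sol [OF S(2)] by (simp add: diff_left diff_right)
  have lim0: "((\<lambda>z. (norm (c z - c x) + K * norm (y x) * norm (g z - g x)) * (2 / m)) \<longlongrightarrow> 0) (at x)"
  proof -
    have "(c \<longlongrightarrow> c x) (at x)" "(g \<longlongrightarrow> g x) (at x)"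
      using g c by (auto dest!: differentiable_imp_continuous_within simp: continuous_within)
    then have "((\<lambda>z. (norm (c z - c x) + K * norm (y x) * norm (g z - g x)) * (2 / m)) \<longlongrightarrow>
        (norm (c x - c x) + K * norm (y x) * norm (g x - g x)) * (2 / m)) (at x)"
      by (intro tendsto_intros)
    then show ?thesis by simp
  qed
  have evS: "eventually (\<lambda>z. z \<in> S) (at x)" using S by (simp add: eventually_at_in_open')
  have "((\<lambda>z. K * norm (g z - g x)) \<longlongrightarrow> K * norm (g x - g x)) (at x)"
    using g by (intro tendsto_intros) (auto dest!: differentiable_imp_continuous_within simp: continuous_within)
  \<comment> \<open>Where the perturbation is below \<open>m / 2\<close>, its share of
    \<open>norm (y z - y x)\<close> is absorbed into the left side; hence the factor
    \<open>2 / m\<close> in \<open>lim0\<close>.\<close>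
  then have evg: "eventually (\<lambda>z. K * norm (g z - g x) < m / 2) (at x)"
    using m(1) by (intro order_tendstoD(2)) auto
  have "((\<lambda>z. y z - y x) \<longlongrightarrow> 0) (at x)"
  proof (rule Lim_null_comparison [OF _ lim0], use eventually_conj [OF evS evg] in eventually_elim)
    case (elim z)
    let ?a = "norm (y z - y x)" and ?b = "norm (g z - g x)"
    have "m * ?a \<le> norm (c z - c x) + norm (\<beta> (g z - g x) (y z))"
      using m(2) [of "y z - y x"] key [of z] elim norm_triangle_ineq4 [of "c z - c x" "\<beta> (g z - g x) (y z)"]
      by simp
    also have "norm (\<beta> (g z - g x) (y z)) \<le> ?b * norm (y z) * K" by (rule K)
    also have "?b * norm (y z) * K \<le> ?b * (?a + norm (y x)) * K"
      using K(1) norm_triangle_ineq [of "y z - y x" "y x"] by (intro mult_right_mono mult_left_mono) auto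
    also have "\<dots> = (K * ?b) * ?a + K * norm (y x) * ?b" by (simp add: algebra_simps)
    also have "(K * ?b) * ?a \<le> (m / 2) * ?a" using elim by (intro mult_right_mono) auto
    finally show ?case using m(1) by (simp add: field_simps)
  qed
  then have "isCont y x" unfolding isCont_def by (simp add: Lim_null [of y])
  moreover have "((\<lambda>z. g z - g x) has_derivative FD g x) (at x)"
    using FD_works [OF g] by (auto intro!: derivative_eq_intros)
  ultimately have "((\<lambda>z. \<beta> (g z - g x) (y z)) has_derivative (\<lambda>h. \<beta> (FD g x h) (y x))) (at x)"
    by (intro has_derivative_bilinear_zero [OF \<beta>]) auto
  then have "((\<lambda>z. (c z - c x) - \<beta> (g z - g x) (y z)) has_derivative
      (\<lambda>h. FD c x h - \<beta> (FD g x h) (y x))) (at x)"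
    using FD_works [OF c] by (auto intro!: derivative_eq_intros)
  then have "((\<lambda>z. y x + T ((c z - c x) - \<beta> (g z - g x) (y z))) has_derivative
      (\<lambda>h. T (FD c x h - \<beta> (FD g x h) (y x)))) (at x)"
    using bounded_linear.has_derivative [OF T(1) [unfolded linear_conv_bounded_linear]]
    by (auto intro!: derivative_eq_intros)
  then have "(y has_derivative (\<lambda>h. T (FD c x h - \<beta> (FD g x h) (y x)))) (at x)"
  proof (rule has_derivative_transform_within_open [OF _ S])
    fix z assume "z \<in> S"
    from key [OF this] have "T ((c z - c x) - \<beta> (g z - g x) (y z)) = y z - y x"
      using T(2) by (metis comp_apply id_apply)
    then show "y x + T ((c z - c x) - \<beta> (g z - g x) (y z)) = y z" by simp
  qed
  then show ?thesis by (auto simp: differentiable_def)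
qed

text \<open>A directional derivative of \<open>y\<close> solves a system with the same operator,
  whose right side involves only \<open>y\<close> itself and first derivatives of the data. So the
  preceding lemma applies a second time.\<close>

lemma twice_differentiable_linear_system:
  fixes \<beta> :: "'m::real_normed_vector \<Rightarrow> 'b::euclidean_space \<Rightarrow> 'c::euclidean_space"
    and g :: "'a::real_normed_vector \<Rightarrow> 'm"
  assumes \<beta>: "bounded_bilinear \<beta>" and inj: "\<And>x. x \<in> S \<Longrightarrow> inj (\<beta> (g x))"
    and g: "twice_differentiable_on g S" and c: "twice_differentiable_on c S"
    and S: "open S" and sol: "\<And>z. z \<in> S \<Longrightarrow> \<beta> (g z) (y z) = c z"
  shows "twice_differentiable_on y S"
proof -
  have y: "y differentiable (at x)" if "x \<in> S" for x
    using differentiable_linear_system [where \<beta>=\<beta> and g=g and c=c and y=y and S=S and x=x, OF \<beta> inj [OF that] _ _ S that sol]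
      twice_differentiable_onD(1) [OF g that] twice_differentiable_onD(1) [OF c that] by blast
  have sol': "\<beta> (g x) (FD y x v) = FD c x v - \<beta> (FD g x v) (y x)" if x: "x \<in> S" for x v
  proof -
    have "((\<lambda>z. \<beta> (g z) (y z)) has_derivative (\<lambda>h. \<beta> (g x) (FD y x h) + \<beta> (FD g x h) (y x))) (at x)"
      using bounded_bilinear.FDERIV [OF \<beta> FD_works FD_works] y [OF x] twice_differentiable_onD(1) [OF g x]
      by blast
    then have "(c has_derivative (\<lambda>h. \<beta> (g x) (FD y x h) + \<beta> (FD g x h) (y x))) (at x)"
      by (rule has_derivative_transform_within_open [OF _ S x]) (simp add: sol)
    from FD_eq [OF this] show ?thesis by simp
  qed
  have "(\<lambda>x. FD y x v) differentiable (at x)" if x: "x \<in> S" for x v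
  proof (rule differentiable_linear_system [where \<beta>=\<beta> and g=g and S=S and x=x, OF \<beta> inj [OF x] _ _ S x sol'])
    show "g differentiable (at x)" by (rule twice_differentiable_onD(1) [OF g x])
    show "(\<lambda>z. FD c z v - \<beta> (FD g z v) (y z)) differentiable (at x)"
      using bounded_bilinear.FDERIV [OF \<beta> FD_works [OF twice_differentiable_onD(2) [OF g x]] FD_works [OF y [OF x]]]
      by (intro differentiable_diff twice_differentiable_onD(2) [OF c x]) (auto simp: differentiable_def)
  qed
  with y show ?thesis by (simp add: twice_differentiable_on_def)
qed

section \<open>The Gram map\<close>

lemma bounded_bilinear_of_bilinear:
  fixes B :: "'a::euclidean_space \<Rightarrow> 'b::euclidean_space \<Rightarrow> 'c::real_normed_vector"
  assumes "\<And>x y z. B (x + y) z = B x z + B y z" "\<And>x y z. B x (y + z) = B x y + B x z"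
    "\<And>c x y. B (c *\<^sub>R x) y = c *\<^sub>R B x y" "\<And>c x y. B x (c *\<^sub>R y) = c *\<^sub>R B x y"
  shows "bounded_bilinear B"
  unfolding bilinear_conv_bounded_bilinear [symmetric] bilinear_def
  using assms by (auto intro!: linearI)

lemma smooth_on_const: "smooth_on (\<lambda>x. c :: 'b::real_normed_vector) S"
proof -
  have "Ck_on k (\<lambda>x. c) S" for k and c :: 'b by (induction k arbitrary: c) auto
  then show ?thesis unfolding smooth_on_def by blast
qed

lemma Ck_on_Suc_I:
  assumes "\<And>x. (f has_derivative f' x) (at x)" "\<And>v. Ck_on k (\<lambda>x. f' x v) S"
  shows "Ck_on (Suc k) f S"
  using assms FD_eq [OF assms(1)] by (auto simp: differentiable_def)

lemma smooth_on_linear: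
  assumes "bounded_linear L" shows "smooth_on L S"
proof -
  have "Ck_on k L S" for k
  proof (cases k)
    case 0
    then show ?thesis using assms by (simp add: linear_continuous_on)
  next
    case (Suc j)
    then show ?thesis
      using smooth_on_const [unfolded smooth_on_def]
      by (auto intro!: Ck_on_Suc_I bounded_linear_imp_has_derivative [OF assms] simp del: Ck_on.simps)
  qed
  then show ?thesis by (simp add: smooth_on_def)
qed

lemma smooth_on_quadratic:
  assumes B: "bounded_bilinear B" shows "smooth_on (\<lambda>x. B x x) S"
proof -
  have D: "((\<lambda>x. B x x) has_derivative (\<lambda>h. B x h + B h x)) (at x)" for x
    using bounded_bilinear.FDERIV [OF B has_derivative_ident has_derivative_ident] .
  have L: "bounded_linear (\<lambda>x. B x v + B v x)" for v
    by (intro bounded_linear_add bounded_bilinear.bounded_linear_left [OF B]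
        bounded_bilinear.bounded_linear_right [OF B])
  have "Ck_on k (\<lambda>x. B x x) S" for k
  proof (cases k)
    case 0
    then show ?thesis
      using D by (auto intro!: continuous_at_imp_continuous_on has_derivative_continuous)
  next
    case (Suc j)
    then show ?thesis
      using Ck_on_Suc_I [OF D] smooth_on_linear [OF L, unfolded smooth_on_def] by simp
  qed
  then show ?thesis by (simp add: smooth_on_def)
qed

lemma twice_differentiable_on_bilinear:
  assumes B: "bounded_bilinear B" and S: "open S"
    and f: "twice_differentiable_on f S" and g: "twice_differentiable_on g S"
  shows "twice_differentiable_on (\<lambda>x. B (f x) (g x)) S"
proof -
  have D: "((\<lambda>x. B (f x) (g x)) has_derivative (\<lambda>h. B (f x) (FD g x h) + B (FD f x h) (g x))) (at x)"
    if "x \<in> S" for x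
    using twice_differentiable_onD(1) [OF f that] twice_differentiable_onD(1) [OF g that]
    by (intro bounded_bilinear.FDERIV [OF B] FD_works)
  have "(\<lambda>y. FD (\<lambda>x. B (f x) (g x)) y v) differentiable (at x)" if x: "x \<in> S" for x v
  proof -
    have "((\<lambda>y. B (f y) (FD g y v) + B (FD f y v) (g y)) has_derivative
        (\<lambda>h. (B (f x) (FD (\<lambda>y. FD g y v) x h) + B (FD f x h) (FD g x v))
          + (B (FD f x v) (FD g x h) + B (FD (\<lambda>y. FD f y v) x h) (g x)))) (at x)"
      using twice_differentiable_onD [OF f x] twice_differentiable_onD [OF g x]
      by (intro has_derivative_add bounded_bilinear.FDERIV [OF B] FD_works) auto
    then have "((\<lambda>y. FD (\<lambda>x. B (f x) (g x)) y v) has_derivative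
        (\<lambda>h. (B (f x) (FD (\<lambda>y. FD g y v) x h) + B (FD f x h) (FD g x v))
          + (B (FD f x v) (FD g x h) + B (FD (\<lambda>y. FD f y v) x h) (g x)))) (at x)"
      by (rule has_derivative_transform_within_open [OF _ S x]) (simp add: FD_eq [OF D])
    then show ?thesis by (auto simp: differentiable_def)
  qed
  moreover have "(\<lambda>x. B (f x) (g x)) differentiable (at x)" if "x \<in> S" for x
    using D [OF that] by (auto simp: differentiable_def)
  ultimately show ?thesis by (simp add: twice_differentiable_on_def)
qed

section \<open>The differential of the Gram map, its domain and its fibres\<close>

definition dgram :: "real^'d^'n \<Rightarrow> real^'d^'n \<Rightarrow> real^'n^'n" where
  "dgram X U = U ** transpose X + X ** transpose U"

lemma bounded_bilinear_dgram: "bounded_bilinear dgram"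
  by (rule bounded_bilinear_of_bilinear) (simp_all add: dgram_def matrix_algebra scaleR_add_right add_ac)

lemma linear_dgram: "linear (dgram X)"
  using bounded_bilinear.bounded_linear_right [OF bounded_bilinear_dgram] bounded_linear.linear by blast

lemma dgram_commute: "dgram X U = dgram U X"
  by (simp add: dgram_def add.commute)

lemma gram_has_derivative: "(gram has_derivative dgram X) (at X)"
proof -
  have "((\<lambda>X. X ** transpose X) has_derivative (\<lambda>U. X ** transpose U + U ** transpose X)) (at X)"
    by (intro bounded_bilinear.FDERIV [OF bounded_bilinear_matrix_mult] has_derivative_ident
        bounded_linear_imp_has_derivative bounded_linear_transpose)
  then show ?thesis unfolding gram_def [abs_def] dgram_def [abs_def] by (simp add: add.commute)
qed

lemma FD_gram: "FD gram X = dgram X"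
  by (rule FD_eq [OF gram_has_derivative])

lemma inner_row_gram: "inner (row i X) (row j X) = gram X $ i $ j"
  by (simp add: gram_def matrix_mult_transpose_dot_row)

lemma gram_domain_left_inverse:
  fixes X :: "real^'d^'n"
  assumes "X \<in> gram_domain"
  obtains L :: "real^'n^'d" where "L ** X = mat 1"
  using assms unfolding gram_domain_def mem_Collect_eq full_rank_injective
  by (auto simp: matrix_left_invertible_injective [symmetric])

lemma gram_domain_iff:
  fixes X :: "real^'d^'n"
  shows "X \<in> gram_domain \<longleftrightarrow> (\<exists>L :: real^'n^'d. L ** X = mat 1) \<and> (\<forall>i j. 0 < gram X $ i $ j \<and> gram X $ i $ j < 1)"
  unfolding gram_domain_def mem_Collect_eq full_rank_injective inner_row_gram
  by (simp add: matrix_left_invertible_injective)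

text \<open>Full column rank is a union over \<open>L\<close> of the open conditions
  \<open>det (L ** X) \<noteq> 0\<close>: an inverse of \<open>L ** X\<close>, composed with
  \<open>L\<close>, is a left inverse of \<open>X\<close>.\<close>

lemma open_gram_domain: "open (gram_domain :: (real^'d^'n) set)"
proof -
  have "(\<exists>L' :: real^'n^'d. L' ** X = mat 1) \<longleftrightarrow> (\<exists>L :: real^'n^'d. det (L ** X) \<noteq> 0)" for X :: "real^'d^'n"
  proof
    assume "\<exists>L :: real^'n^'d. det (L ** X) \<noteq> 0"
    then obtain L :: "real^'n^'d" and M where "M ** (L ** X) = mat 1"
      using invertible_det_nz invertible_left_inverse by blast
    then show "\<exists>L' :: real^'n^'d. L' ** X = mat 1" by (metis matrix_mul_assoc)
  qed (metis det_I zero_neq_one)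
  then have eq: "(gram_domain :: (real^'d^'n) set) = (\<Union>L :: real^'n^'d. {X. det (L ** X) \<noteq> 0}) \<inter>
      (\<Inter>i. \<Inter>j. {X. 0 < gram X $ i $ j} \<inter> {X. gram X $ i $ j < 1})"
    unfolding set_eq_iff gram_domain_iff by auto
  have "continuous_on UNIV (\<lambda>X. det (L ** X))" for L :: "real^'n^'d"
  proof -
    have "continuous_on UNIV (\<lambda>X :: real^'d^'n. L ** X)"
      by (rule linear_continuous_on)
        (rule bounded_bilinear.bounded_linear_right [OF bounded_bilinear_matrix_mult])
    then show ?thesis unfolding det_def by (intro continuous_intros)
  qed
  then have "open {X. det (L ** X) \<noteq> 0}" for L :: "real^'n^'d"
    by (intro open_Collect_neq continuous_on_const)
  moreover have "continuous_on UNIV (\<lambda>X :: real^'d^'n. gram X $ i $ j)" for i j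
  proof -
    have "continuous_on UNIV (gram :: real^'d^'n \<Rightarrow> _)"
      using has_derivative_continuous [OF gram_has_derivative] by (auto intro: continuous_at_imp_continuous_on)
    then show ?thesis by (intro continuous_intros)
  qed
  then have "open ({X :: real^'d^'n. 0 < gram X $ i $ j} \<inter> {X. gram X $ i $ j < 1})" for i j
    by (intro open_Int open_Collect_less continuous_on_const)
  ultimately show ?thesis
    unfolding eq by (intro open_Int [OF open_UN open_INT] open_INT ballI finite_class.finite_UNIV)
qed

lemma gram_mult_orthogonal:
  assumes "orthogonal_matrix Q" shows "gram (X ** Q) = gram X"
proof -
  have "gram (X ** Q) = X ** (Q ** transpose Q) ** transpose X"
    by (simp add: gram_def matrix_transpose_mul matrix_mul_assoc)
  with assms show ?thesis by (simp add: orthogonal_matrix_def gram_def)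
qed

lemma gram_domain_mult_orthogonal:
  assumes Q: "orthogonal_matrix Q" and X: "X \<in> gram_domain"
  shows "X ** Q \<in> gram_domain"
proof -
  obtain L where L: "L ** X = mat 1" using gram_domain_left_inverse [OF X] .
  have "(transpose Q ** L) ** (X ** Q) = transpose Q ** (L ** X) ** Q" by (simp add: matrix_mul_assoc)
  also have "\<dots> = mat 1" using Q by (simp add: L orthogonal_matrix_def)
  finally show ?thesis using X by (auto simp: gram_domain_iff gram_mult_orthogonal [OF Q])
qed

text \<open>With a left inverse \<open>M\<close> of \<open>Y\<close> one has
  \<open>Y = gram Y ** transpose M = gram X ** transpose M\<close>, which begins with the factor
  \<open>X\<close>; the rest is \<open>Q\<close>. Cancelling \<open>X\<close> on both sides of
  \<open>gram (X ** Q) = gram X\<close> makes \<open>Q\<close> orthogonal.\<close>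

lemma gram_fibre:
  assumes X: "X \<in> gram_domain" and Y: "Y \<in> gram_domain" and eq: "gram X = gram Y"
  obtains Q where "orthogonal_matrix Q" "Y = X ** Q"
proof -
  obtain L where L: "L ** X = mat 1" using gram_domain_left_inverse [OF X] .
  obtain M where M: "M ** Y = mat 1" using gram_domain_left_inverse [OF Y] .
  define Q where "Q = transpose X ** transpose M"
  have "Y = Y ** transpose (M ** Y)" by (simp add: M)
  also have "\<dots> = gram Y ** transpose M" by (simp add: gram_def matrix_transpose_mul matrix_mul_assoc)
  also have "\<dots> = X ** Q" by (simp add: eq [symmetric] Q_def) (simp add: gram_def matrix_mul_assoc)
  finally have YXQ: "Y = X ** Q" .
  have "X ** (Q ** transpose Q) ** transpose X = X ** mat 1 ** transpose X"
    using eq by (simp add: YXQ gram_def matrix_transpose_mul matrix_mul_assoc)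
  from right_inverse_inj [OF L this] have "X ** (Q ** transpose Q) = X ** mat 1" .
  from left_inverse_inj [OF L this] have "Q ** transpose Q = mat 1" .
  then have "orthogonal_matrix Q" by (metis orthogonal_matrix_def matrix_left_right_inverse)
  with YXQ that show ?thesis by blast
qed

lemma dgram_mult_orthogonal:
  "dgram (X ** Q) U = dgram X (U ** transpose Q)"
  by (simp add: dgram_def matrix_algebra)

text \<open>Multiplying \<open>U ** transpose X = - (X ** transpose U)\<close> by the transpose of a
  left inverse of \<open>X\<close> gives \<open>U\<close> the form \<open>X ** A\<close>, and
  cancelling \<open>X\<close> on both sides makes \<open>A\<close> skew. So the vertical vectors are
  the tangent vectors of the O(d)-orbit.\<close>

lemma dgram_eq_0_iff:
  assumes X: "X \<in> gram_domain"
  shows "dgram X U = 0 \<longleftrightarrow> (\<exists>A. skew A \<and> U = X ** A)"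
proof
  assume 0: "dgram X U = 0"
  obtain L where L: "L ** X = mat 1" using gram_domain_left_inverse [OF X] .
  define A where "A = - (transpose U ** transpose L)"
  have eq: "U ** transpose X = - (X ** transpose U)"
    using 0 by (simp add: dgram_def add_eq_0_iff2)
  have "U = U ** transpose (L ** X)" by (simp add: L)
  also have "\<dots> = (U ** transpose X) ** transpose L" by (simp add: matrix_algebra)
  also have "\<dots> = X ** A" unfolding eq by (simp add: A_def matrix_algebra)
  finally have U: "U = X ** A" .
  have "(X ** A) ** transpose X = (X ** (- transpose A)) ** transpose X"
    using eq unfolding U by (simp add: matrix_algebra)
  from left_inverse_inj [OF L right_inverse_inj [OF L this]]
  have "A = - transpose A" .
  then have "skew A" unfolding skew_def by (metis minus_minus)
  with U show "\<exists>A. skew A \<and> U = X ** A" by blast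
next
  assume "\<exists>A. skew A \<and> U = X ** A"
  then show "dgram X U = 0" by (auto simp: dgram_def matrix_algebra skew_def)
qed

text \<open>Horizontality is written as symmetry of \<open>transpose X ** U X\<close>, an identity
  on an open set that can be differentiated. \<open>V\<close> is constrained only at points
  \<open>gram X\<close> with \<open>X\<close> in the domain.\<close>

definition horizontal_lift ::
    "(real^'n^'n \<Rightarrow> real^'n^'n) \<Rightarrow> (real^'d^'n \<Rightarrow> real^'d^'n) \<Rightarrow> bool" where
  "horizontal_lift V U \<longleftrightarrow>
     (\<forall>X\<in>gram_domain. symmetric_matrix (transpose X ** U X) \<and> V (gram X) = dgram X (U X))"

text \<open>For symmetric \<open>S\<close>, the velocity at \<open>s = 0\<close> of the congruences
  \<open>q \<mapsto> exp(s S) q exp(s S)\<close>. These are the explicit test fields of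
  \<open>nabla_lift\<close> and \<open>sectional_curvature_commuting\<close>.\<close>

definition sym_field :: "real^'n^'n \<Rightarrow> real^'n^'n \<Rightarrow> real^'n^'n" where
  "sym_field S q = S ** q + q ** S"

lemma sym_field_gram:
  assumes "symmetric_matrix S" shows "sym_field S (gram X) = dgram X (S ** X)"
  using assms by (simp add: sym_field_def gram_def dgram_def symmetric_matrix_def matrix_algebra)

lemma horizontal_sym_field:
  assumes "symmetric_matrix S" shows "symmetric_matrix (transpose X ** (S ** X))"
  using assms by (simp add: symmetric_matrix_def matrix_algebra)

lemma horizontal_lift_sym_field:
  "symmetric_matrix S \<Longrightarrow> horizontal_lift (sym_field S) (\<lambda>X. S ** X)"
  by (simp add: horizontal_lift_def sym_field_gram horizontal_sym_field)

text \<open>Extends a horizontal vector at one point to the lift of a globally defined field,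
  \<open>sym_field S\<close>. Therefore the test fields reach every tangent vector.\<close>

lemma horizontal_eq_symmetric_mult:
  assumes X: "X \<in> gram_domain" and U: "symmetric_matrix (transpose X ** U)"
  obtains S where "symmetric_matrix S" "U = S ** X"
proof -
  obtain L where L: "L ** X = mat 1" using gram_domain_left_inverse [OF X] .
  have LX: "A ** L ** X = A" for A :: "real^'a^'b" by (simp add: L flip: matrix_mul_assoc)
  have s: "transpose U ** X = transpose X ** U" using U by (simp add: symmetric_matrix_def matrix_algebra)
  \<comment> \<open>\<open>U ** L\<close> already sends \<open>X\<close> to \<open>U\<close> but
    need not be symmetric. Adding its transpose repairs this, and the third term, symmetric because
    \<open>transpose X ** U\<close> is, cancels what the second contributes to
    \<open>S ** X\<close>.\<close>
  define S where "S = U ** L + transpose L ** transpose U - transpose L ** (transpose X ** U) ** L"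
  have "transpose S = S" by (simp add: S_def matrix_algebra s [symmetric])
  moreover have "S ** X = U + transpose L ** (transpose U ** X) - transpose L ** (transpose X ** U)"
    by (simp add: S_def matrix_algebra LX)
  ultimately show ?thesis by (intro that [of S]) (simp_all add: symmetric_matrix_def s)
qed

text \<open>The base \<open>pr ` E\<close> does not determine \<open>'d\<close>, so the type of \<open>E\<close> has to be fixed.\<close>

context
  fixes dims :: "(real^'d^'n) itself"
begin

interpretation rq: riemannian_quotient "gram_domain :: (real^'d^'n) set" gram .

section \<open>Horizontal lifts and the quotient metric\<close>

lemma rq_dpr: "rq.dpr (X :: real^'d^'n) = dgram X"
  unfolding rq.dpr_def FD_gram ..

text \<open>The adjoint of \<open>A \<mapsto> X ** A\<close> is
  \<open>U \<mapsto> transpose X ** U\<close>, so orthogonality to the vertical space says that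
  \<open>transpose X ** U\<close> is orthogonal to the skew matrices.\<close>

lemma mem_horizontal_iff:
  assumes X: "(X :: real^'d^'n) \<in> gram_domain"
  shows "U \<in> rq.horizontal X \<longleftrightarrow> symmetric_matrix (transpose X ** U)"
proof -
  have "U \<in> rq.horizontal X \<longleftrightarrow> (\<forall>A. skew A \<longrightarrow> inner (X ** A) U = 0)"
    unfolding rq.horizontal_def rq_dpr orthogonal_comp_def orthogonal_def
    using dgram_eq_0_iff [OF X] by auto
  also have "\<dots> \<longleftrightarrow> (\<forall>A. skew A \<longrightarrow> inner A (transpose X ** U) = 0)"
    by (simp add: inner_matrix_mult_left)
  finally show ?thesis by (simp add: symmetric_iff_orthogonal_skew)
qed

lemma subspace_horizontal: "subspace (rq.horizontal (X :: real^'d^'n))"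
  unfolding rq.horizontal_def by (rule subspace_orthogonal_comp)

lemma horizontal_decomposition:
  fixes X U :: "real^'d^'n"
  obtains H where "H \<in> rq.horizontal X" "dgram X H = dgram X U"
proof -
  have sub: "subspace {U. rq.dpr X U = 0}"
    by (auto simp: subspace_def rq_dpr linear_0 [OF linear_dgram] linear_add [OF linear_dgram]
        linear_cmul [OF linear_dgram])
  have "U \<in> {U. rq.dpr X U = 0} + rq.horizontal X"
    using subspace_sum_orthogonal_comp [OF sub] unfolding rq.horizontal_def by simp
  then obtain K H where "K \<in> {U. rq.dpr X U = 0}" "H \<in> rq.horizontal X" "U = K + H"
    by (rule set_plus_elim)
  then show ?thesis using that by (auto simp: rq_dpr linear_add [OF linear_dgram])
qed

lemma horizontal_inner_eq:
  fixes X :: "real^'d^'n"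
  assumes "Z \<in> rq.horizontal X" "dgram X H = dgram X U"
  shows "inner H Z = inner U Z"
proof -
  have "dgram X (H - U) = 0" using assms(2) by (simp add: linear_diff [OF linear_dgram])
  then have "inner (H - U) Z = 0"
    using assms(1) by (auto simp: rq.horizontal_def orthogonal_comp_def orthogonal_def rq_dpr)
  then show ?thesis by (simp add: inner_diff_left)
qed

lemma horizontal_unique:
  fixes X :: "real^'d^'n"
  assumes "H \<in> rq.horizontal X" "U \<in> rq.horizontal X" "dgram X H = dgram X U"
  shows "H = U"
proof -
  have "H - U \<in> rq.horizontal X" using assms subspace_diff subspace_horizontal by blast
  from horizontal_inner_eq [OF this assms(3)] have "inner (H - U) (H - U) = 0"
    by (simp add: inner_diff_left)
  then show ?thesis by simp
qed

lemma hlift_eq: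
  fixes X :: "real^'d^'n"
  assumes "U \<in> rq.horizontal X"
  shows "rq.hlift X (dgram X U) = U"
  unfolding rq.hlift_def rq_dpr using assms horizontal_unique by blast

lemma
  fixes X :: "real^'d^'n"
  shows hlift_horizontal: "rq.hlift X (dgram X U) \<in> rq.horizontal X"
    and dgram_hlift: "dgram X (rq.hlift X (dgram X U)) = dgram X U"
  using horizontal_decomposition [of X U] hlift_eq by metis+

text \<open>\<open>rq.hlift X (dgram X U)\<close> is the horizontal projection of \<open>U\<close>.
  The projection may thus be dropped in every product with a horizontal vector.\<close>

lemma inner_hlift:
  fixes X :: "real^'d^'n"
  shows "Z \<in> rq.horizontal X \<Longrightarrow> inner (rq.hlift X (dgram X U)) Z = inner U Z"
  by (rule horizontal_inner_eq [OF _ dgram_hlift])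

text \<open>The definition of \<open>tangent\<close> collects images from the whole fibre; they
  coincide because the differential at \<open>X ** Q\<close> is the one at \<open>X\<close> after
  right multiplication by \<open>transpose Q\<close>.\<close>

lemma rq_tangent:
  assumes X: "(X :: real^'d^'n) \<in> gram_domain"
  shows "rq.tangent (gram X) = range (dgram X)"
proof -
  have "dgram Y U \<in> range (dgram X)" if Y: "Y \<in> gram_domain" "gram Y = gram X" for Y U :: "real^'d^'n"
  proof -
    obtain Q where "orthogonal_matrix Q" "Y = X ** Q" using gram_fibre [OF X Y(1) Y(2) [symmetric]] .
    then show ?thesis by (simp add: dgram_mult_orthogonal)
  qed
  with X show ?thesis unfolding rq.tangent_def rq_dpr by auto
qed

lemma horizontal_mult_orthogonal:
  assumes Q: "orthogonal_matrix Q" and X: "(X :: real^'d^'n) \<in> gram_domain" and U: "U \<in> rq.horizontal X"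
  shows "U ** Q \<in> rq.horizontal (X ** Q)"
proof -
  have s: "transpose (transpose X ** U) = transpose X ** U"
    using U by (simp add: mem_horizontal_iff [OF X] symmetric_matrix_def)
  have "transpose (X ** Q) ** (U ** Q) = transpose Q ** (transpose X ** U) ** Q"
    by (simp add: matrix_algebra)
  then show ?thesis
    using s by (simp add: mem_horizontal_iff [OF gram_domain_mult_orthogonal [OF Q X]]
        symmetric_matrix_def matrix_transpose_mul matrix_mul_assoc)
qed

lemma hlift_mult_orthogonal:
  assumes Q: "orthogonal_matrix Q" and X: "(X :: real^'d^'n) \<in> gram_domain"
  shows "rq.hlift (X ** Q) (dgram X U) = rq.hlift X (dgram X U) ** Q"
proof -
  let ?H = "rq.hlift X (dgram X U)"
  have "dgram (X ** Q) (?H ** Q) = dgram X (?H ** (Q ** transpose Q))"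
    by (simp add: dgram_mult_orthogonal matrix_mul_assoc)
  also have "\<dots> = dgram X U" using Q by (simp add: orthogonal_matrix_def dgram_hlift)
  finally show ?thesis
    using hlift_eq [OF horizontal_mult_orthogonal [OF Q X hlift_horizontal [of X U]]] by simp
qed

text \<open>The definite description demands one value on the whole fibre: lifts at
  \<open>X ** Q\<close> are the lifts at \<open>X\<close> times \<open>Q\<close>, and this
  multiplication preserves the Frobenius product.\<close>

lemma metric_dgram:
  assumes X: "(X :: real^'d^'n) \<in> gram_domain"
  shows "rq.metric (gram X) (dgram X U) (dgram X W)
    = inner (rq.hlift X (dgram X U)) (rq.hlift X (dgram X W))"
  unfolding rq.metric_def
proof (rule the_equality)
  show "\<forall>Y\<in>gram_domain. gram Y = gram X \<longrightarrow>
    inner (rq.hlift X (dgram X U)) (rq.hlift X (dgram X W))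
      = inner (rq.hlift Y (dgram X U)) (rq.hlift Y (dgram X W))"
  proof (intro ballI impI)
    fix Y :: "real^'d^'n" assume Y: "Y \<in> gram_domain" "gram Y = gram X"
    obtain Q where Q: "orthogonal_matrix Q" "Y = X ** Q" using gram_fibre [OF X Y(1) Y(2) [symmetric]] .
    show "inner (rq.hlift X (dgram X U)) (rq.hlift X (dgram X W))
      = inner (rq.hlift Y (dgram X U)) (rq.hlift Y (dgram X W))"
      using Q(1) by (simp add: Q(2) hlift_mult_orthogonal [OF Q(1) X] inner_matrix_mult_right
          matrix_mul_assoc [symmetric] orthogonal_matrix_def)
  qed
qed (use X in blast)

section \<open>Derivatives on the base\<close>

text \<open>\<open>F (gram _)\<close> is constant along the curve \<open>X ** ?R s\<close> of
  rotated points, whose velocity at 0 is \<open>X ** J\<close>. The linear map \<open>D\<close> then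
  vanishes on all combinations of these velocities.\<close>

lemma derivative_vertical_eq_0:
  fixes F :: "real^'n^'n \<Rightarrow> 'c::real_normed_vector" and X :: "real^'d^'n"
  assumes D: "((\<lambda>X :: real^'d^'n. F (gram X)) has_derivative D) (at X)" and A: "skew A"
  shows "D (X ** A) = 0"
proof -
  have lin: "linear D" using D has_derivative_linear by blast
  have J: "D (X ** plane_rotation i j) = 0" for i j
  proof (cases "i = j")
    case True
    then have "plane_rotation i j = 0" by (simp add: plane_rotation_def vec_eq_iff)
    then show ?thesis by (simp add: matrix_algebra linear_0 [OF lin])
  next
    case False
    define J :: "real^'d^'d" where "J = plane_rotation i j"
    let ?R = "\<lambda>s. mat 1 + sin s *\<^sub>R J + (1 - cos s) *\<^sub>R (J ** J)"
    have R: "orthogonal_matrix (?R s)" for s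
      unfolding J_def using rotation_curve_orthogonal [OF skew_plane_rotation plane_rotation_cube [OF False]] .
    have "(?R has_derivative (\<lambda>r. r *\<^sub>R J)) (at 0)"
      by (auto intro!: derivative_eq_intros)
    then have 1: "((\<lambda>s. X ** ?R s) has_derivative (\<lambda>r. X ** (r *\<^sub>R J))) (at 0)"
      by (rule bounded_linear.has_derivative [OF bounded_bilinear.bounded_linear_right [OF bounded_bilinear_matrix_mult]])
    have "((\<lambda>s. F (gram (X ** ?R s))) has_derivative (\<lambda>r. D (X ** (r *\<^sub>R J)))) (at 0)"
      by (rule has_derivative_compose [OF 1]) (use D in simp)
    then have "((\<lambda>s. F (gram X)) has_derivative (\<lambda>r. D (X ** (r *\<^sub>R J)))) (at (0::real))"
      by (simp add: gram_mult_orthogonal [OF R])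
    then have "(\<lambda>r. D (X ** (r *\<^sub>R J))) = (\<lambda>r. 0)"
      using has_derivative_unique has_derivative_const by blast
    from fun_cong [OF this, of 1] show ?thesis by (simp add: J_def)
  qed
  have "X ** A = (1/2) *\<^sub>R (\<Sum>i\<in>UNIV. \<Sum>j\<in>UNIV. (A $ i $ j) *\<^sub>R (X ** plane_rotation i j))"
    by (subst skew_eq_sum_plane_rotation [OF A]) (simp add: matrix_sum_right matrix_scaleR_simps)
  then show ?thesis
    by (simp add: linear_cmul [OF lin] linear_sum [OF lin] J)
qed

text \<open>\<open>deriv_along\<close> asks for the same derivative along every straight line
  representing the tangent vector. A line through \<open>Y = X ** Q\<close> is moved to
  \<open>X\<close> by \<open>transpose Q\<close> without changing \<open>gram\<close>, and its
  direction then differs from \<open>U\<close> by a vertical vector, which \<open>D\<close>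
  annihilates.\<close>

lemma deriv_along_dgram:
  fixes F :: "real^'n^'n \<Rightarrow> 'c::real_normed_vector" and X :: "real^'d^'n"
  assumes X: "X \<in> gram_domain" and D: "((\<lambda>X :: real^'d^'n. F (gram X)) has_derivative D) (at X)"
  shows "rq.deriv_along F (gram X) (dgram X U) = D U"
proof -
  have lin: "linear D" using D has_derivative_linear by blast
  have *: "((\<lambda>s. F (gram (X + s *\<^sub>R K))) has_vector_derivative D K) (at 0)" for K
  proof -
    have "((\<lambda>s. X + s *\<^sub>R K) has_derivative (\<lambda>r. r *\<^sub>R K)) (at 0)" by (auto intro!: derivative_eq_intros)
    then have "((\<lambda>s. F (gram (X + s *\<^sub>R K))) has_derivative (\<lambda>r. D (r *\<^sub>R K))) (at 0)"
      by (rule has_derivative_compose) (use D in simp)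
    then show ?thesis by (simp add: has_vector_derivative_def linear_cmul [OF lin])
  qed
  show ?thesis
    unfolding rq.deriv_along_def rq_dpr
  proof (rule the_equality)
    show "\<forall>Y\<in>(gram_domain :: (real^'d^'n) set). \<forall>W. gram Y = gram X \<and> dgram Y W = dgram X U \<longrightarrow>
       ((\<lambda>s. F (gram (Y + s *\<^sub>R W))) has_vector_derivative D U) (at 0)"
    proof (intro ballI allI impI, elim conjE)
      fix Y W :: "real^'d^'n" assume Y: "Y \<in> gram_domain" "gram Y = gram X" and W: "dgram Y W = dgram X U"
      obtain Q where Q: "orthogonal_matrix Q" "Y = X ** Q" using gram_fibre [OF X Y(1) Y(2) [symmetric]] .
      let ?K = "W ** transpose Q"
      have "dgram X (?K - U) = 0" using W Q(2) by (simp add: linear_diff [OF linear_dgram] dgram_mult_orthogonal)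
      then obtain A where "skew A" "?K - U = X ** A" using dgram_eq_0_iff [OF X] by blast
      then have "D (?K - U) = 0" using derivative_vertical_eq_0 [OF D] by simp
      then have "D ?K = D U" by (simp add: linear_diff [OF lin])
      moreover have "Y + s *\<^sub>R W = (X + s *\<^sub>R ?K) ** Q" for s
        using Q(1) by (simp add: Q(2) matrix_algebra orthogonal_matrix_def flip: matrix_mul_assoc)
      ultimately show "((\<lambda>s. F (gram (Y + s *\<^sub>R W))) has_vector_derivative D U) (at 0)"
        using * [of ?K] by (simp add: gram_mult_orthogonal [OF Q(1)])
    qed
  next
    fix d assume "\<forall>Y\<in>(gram_domain :: (real^'d^'n) set). \<forall>W. gram Y = gram X \<and> dgram Y W = dgram X U \<longrightarrow>
       ((\<lambda>s. F (gram (Y + s *\<^sub>R W))) has_vector_derivative d) (at 0)"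
    then have "((\<lambda>s. F (gram (X + s *\<^sub>R U))) has_vector_derivative d) (at 0)" using X by blast
    then show "d = D U" using * [of U] vector_derivative_unique_at by blast
  qed
qed

lemma horizontal_liftD:
  assumes "horizontal_lift V (U :: real^'d^'n \<Rightarrow> real^'d^'n)" "X \<in> gram_domain"
  shows "U X \<in> rq.horizontal X" "V (gram X) = dgram X (U X)" "rq.hlift X (V (gram X)) = U X"
proof -
  show 1: "U X \<in> rq.horizontal X" and 2: "V (gram X) = dgram X (U X)"
    using assms by (auto simp: horizontal_lift_def mem_horizontal_iff)
  show "rq.hlift X (V (gram X)) = U X" unfolding 2 using hlift_eq 1 .
qed

text \<open>Brackets and covariant derivatives come with a representative \<open>c\<close> that need
  not be horizontal; its projection is the lift.\<close>

lemma horizontal_lift_hlift: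
  assumes "\<And>X. X \<in> gram_domain \<Longrightarrow> V (gram X) = dgram X (c X)"
  shows "horizontal_lift V (\<lambda>X :: real^'d^'n. rq.hlift X (dgram X (c X)))"
  unfolding horizontal_lift_def
proof (intro ballI conjI)
  fix X :: "real^'d^'n" assume X: "X \<in> gram_domain"
  show "symmetric_matrix (transpose X ** rq.hlift X (dgram X (c X)))"
    using hlift_horizontal mem_horizontal_iff [OF X] by blast
  show "V (gram X) = dgram X (rq.hlift X (dgram X (c X)))"
    unfolding dgram_hlift by (rule assms [OF X])
qed

lemma metric_lift:
  assumes "horizontal_lift V A" "horizontal_lift W B" "(X :: real^'d^'n) \<in> gram_domain"
  shows "rq.metric (gram X) (V (gram X)) (W (gram X)) = inner (A X) (B X)"
proof -
  note A = horizontal_liftD [OF assms(1,3)] and B = horizontal_liftD [OF assms(2,3)]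
  show ?thesis
    unfolding A(2) B(2) metric_dgram [OF assms(3)] hlift_eq [OF A(1)] hlift_eq [OF B(1)] ..
qed

text \<open>The lift of \<open>v\<close> solves the linear system
  \<open>U (X\<^sup>T X) + (X X\<^sup>T) U = v X\<close>, whose operator is positive definite; hence it depends on the point as
  smoothly as \<open>v\<close> does.\<close>

definition lyapunov :: "(real^'d^'d) \<times> (real^'n^'n) \<Rightarrow> real^'d^'n \<Rightarrow> real^'d^'n" where
  "lyapunov G U = U ** fst G + snd G ** U"

lemma bounded_bilinear_lyapunov: "bounded_bilinear lyapunov"
  by (rule bounded_bilinear_of_bilinear) (simp_all add: lyapunov_def matrix_algebra scaleR_add_right add_ac)

abbreviation lyapunov_coeffs :: "real^'d^'n \<Rightarrow> (real^'d^'d) \<times> (real^'n^'n)" where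
  "lyapunov_coeffs X \<equiv> (transpose X ** X, X ** transpose X)"

lemma twice_differentiable_lyapunov_coeffs: "twice_differentiable_on lyapunov_coeffs S"
proof -
  have "bounded_bilinear (\<lambda>X Y :: real^'d^'n. (transpose X ** Y, X ** transpose Y))"
    by (rule bounded_bilinear_of_bilinear) (simp_all add: matrix_algebra)
  from smooth_on_quadratic [OF this] show ?thesis by (rule smooth_on_imp_twice_differentiable_on)
qed

lemma inj_lyapunov:
  assumes X: "X \<in> gram_domain" shows "inj (lyapunov (lyapunov_coeffs X))"
proof -
  have lin: "linear (lyapunov (lyapunov_coeffs X))"
    using bounded_bilinear.bounded_linear_right [OF bounded_bilinear_lyapunov] bounded_linear.linear by blast
  have "U = 0" if "lyapunov (lyapunov_coeffs X) U = 0" for U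
  proof -
    have "inner (U ** (transpose X ** X)) U = inner (U ** transpose X) (U ** transpose X)"
      using inner_matrix_mult_right [of "U ** transpose X" X U] by (simp add: matrix_mul_assoc)
    moreover have "inner ((X ** transpose X) ** U) U = inner (transpose X ** U) (transpose X ** U)"
      using inner_matrix_mult_left [of X "transpose X ** U" U] by (simp add: matrix_mul_assoc)
    ultimately have "inner (U ** transpose X) (U ** transpose X) + inner (transpose X ** U) (transpose X ** U)
      = inner (lyapunov (lyapunov_coeffs X) U) U"
      by (simp add: lyapunov_def inner_add_left)
    also have "\<dots> = 0" by (simp add: that)
    finally have "inner (U ** transpose X) (U ** transpose X) + inner (transpose X ** U) (transpose X ** U) = 0" .
    then have "inner (U ** transpose X) (U ** transpose X) = 0"
      using inner_ge_zero [of "U ** transpose X"] inner_ge_zero [of "transpose X ** U"] by linarith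
    then have "U ** transpose X = 0 ** transpose X" by (simp add: matrix_algebra)
    then show "U = 0" using right_inverse_inj gram_domain_left_inverse [OF X] by metis
  qed
  then show ?thesis using linear_injective_0 [OF lin] by blast
qed

text \<open>Multiply \<open>dgram X H\<close> by \<open>X\<close> on the right and use
  horizontality, \<open>transpose H ** X = transpose X ** H\<close>, to remove the transpose of the
  unknown.\<close>

lemma lyapunov_hlift:
  assumes X: "(X :: real^'d^'n) \<in> gram_domain"
  shows "lyapunov (lyapunov_coeffs X) (rq.hlift X (dgram X U)) = dgram X U ** X"
proof -
  let ?H = "rq.hlift X (dgram X U)"
  have s: "transpose X ** ?H = transpose ?H ** X"
    using hlift_horizontal [of X U] by (simp add: mem_horizontal_iff [OF X] symmetric_matrix_def matrix_transpose_mul)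
  have "dgram X U ** X = dgram X ?H ** X" by (simp add: dgram_hlift)
  also have "\<dots> = ?H ** (transpose X ** X) + X ** (transpose ?H ** X)"
    by (simp add: dgram_def matrix_algebra)
  also have "\<dots> = lyapunov (lyapunov_coeffs X) ?H" by (simp add: lyapunov_def matrix_mul_assoc flip: s)
  finally show ?thesis by simp
qed

lemma hlift_differentiable:
  fixes c :: "real^'d^'n \<Rightarrow> real^'d^'n"
  assumes X: "X \<in> gram_domain" and c: "c differentiable (at X)"
  shows "(\<lambda>X. rq.hlift X (dgram X (c X))) differentiable (at X)"
proof (rule differentiable_linear_system [where g = lyapunov_coeffs and S = gram_domain and x = X,
      OF bounded_bilinear_lyapunov inj_lyapunov [OF X] _ _ open_gram_domain X lyapunov_hlift])
  show "lyapunov_coeffs differentiable (at X)"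
    using twice_differentiable_onD(1) [OF twice_differentiable_lyapunov_coeffs [of UNIV]] by simp
  have "((\<lambda>X. dgram X (c X)) has_derivative (\<lambda>h. dgram X (FD c X h) + dgram h (c X))) (at X)"
    by (intro bounded_bilinear.FDERIV [OF bounded_bilinear_dgram] has_derivative_ident FD_works c)
  then have "((\<lambda>X. dgram X (c X) ** X) has_derivative
      (\<lambda>h. dgram X (c X) ** h + (dgram X (FD c X h) + dgram h (c X)) ** X)) (at X)"
    by (intro bounded_bilinear.FDERIV [OF bounded_bilinear_matrix_mult] has_derivative_ident)
  then show "(\<lambda>X. dgram X (c X) ** X) differentiable (at X)" by (auto simp: differentiable_def)
qed

text \<open>The preimages \<open>c\<close> are chosen pointwise, without regularity. The lift is
  nevertheless twice differentiable, since it solves the Lyapunov system with right side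
  \<open>V (gram X) ** X\<close>.\<close>

lemma vector_field_lift:
  assumes V: "V \<in> rq.vector_fields"
  obtains A :: "real^'d^'n \<Rightarrow> real^'d^'n"
    where "horizontal_lift V A" "twice_differentiable_on A gram_domain"
proof -
  have "\<exists>U. V (gram X) = dgram X U" if X: "X \<in> gram_domain" for X :: "real^'d^'n"
  proof -
    have "gram X \<in> rq.base" using X by (auto simp: rq.base_def)
    then have "V (gram X) \<in> rq.tangent (gram X)" using V by (auto simp: rq.vector_fields_def)
    then show ?thesis using rq_tangent [OF X] by auto
  qed
  then obtain c where c: "\<And>X :: real^'d^'n. X \<in> gram_domain \<Longrightarrow> V (gram X) = dgram X (c X)" by metis
  let ?A = "\<lambda>X. rq.hlift X (dgram X (c X))"
  have "smooth_on (V \<circ> gram) (gram_domain :: (real^'d^'n) set)" using V by (simp add: rq.vector_fields_def)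
  then have "twice_differentiable_on (V \<circ> gram) (gram_domain :: (real^'d^'n) set)"
    by (rule smooth_on_imp_twice_differentiable_on)
  moreover have "twice_differentiable_on (\<lambda>X. X) (gram_domain :: (real^'d^'n) set)"
    by (intro smooth_on_imp_twice_differentiable_on smooth_on_linear bounded_linear_ident)
  ultimately have "twice_differentiable_on (\<lambda>X. (V \<circ> gram) X ** X) (gram_domain :: (real^'d^'n) set)"
    by (rule twice_differentiable_on_bilinear [OF bounded_bilinear_matrix_mult open_gram_domain])
  then have "twice_differentiable_on ?A gram_domain"
    using twice_differentiable_linear_system [where \<beta> = lyapunov and g = lyapunov_coeffs and y = ?A
        and S = gram_domain and c = "\<lambda>X. (V \<circ> gram) X ** X"]
    by (simp add: bounded_bilinear_lyapunov inj_lyapunov twice_differentiable_lyapunov_coeffs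
        open_gram_domain lyapunov_hlift c)
  with horizontal_lift_hlift [OF c] that show ?thesis by blast
qed

lemma sym_field_vector_field:
  assumes S: "symmetric_matrix S" shows "sym_field S \<in> rq.vector_fields"
proof -
  let ?B = "\<lambda>X Y :: real^'d^'n. S ** (X ** transpose Y) + (X ** transpose Y) ** S"
  have "bounded_bilinear ?B"
    by (rule bounded_bilinear_of_bilinear) (simp_all add: matrix_algebra scaleR_add_right add_ac)
  then have "smooth_on (\<lambda>X. ?B X X) gram_domain" by (rule smooth_on_quadratic)
  then have "smooth_on (sym_field S \<circ> gram) (gram_domain :: (real^'d^'n) set)"
    by (simp add: comp_def sym_field_def gram_def)
  moreover have "sym_field S p \<in> rq.tangent p" if "p \<in> rq.base" for p
    using that by (auto simp: rq.base_def rq_tangent sym_field_gram [OF S])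
  ultimately show ?thesis by (simp add: rq.vector_fields_def)
qed

section \<open>The Levi-Civita connection\<close>

lemma field_has_derivative:
  assumes A: "horizontal_lift V A" and X: "(X :: real^'d^'n) \<in> gram_domain" and dA: "A differentiable (at X)"
  shows "((\<lambda>X. V (gram X)) has_derivative (\<lambda>h. dgram X (FD A X h) + dgram h (A X))) (at X)"
proof -
  have "((\<lambda>X. dgram X (A X)) has_derivative (\<lambda>h. dgram X (FD A X h) + dgram h (A X))) (at X)"
    by (intro bounded_bilinear.FDERIV [OF bounded_bilinear_dgram] has_derivative_ident FD_works dA)
  then show ?thesis
    by (rule has_derivative_transform_within_open [OF _ open_gram_domain X])
      (simp add: horizontal_liftD [OF A])
qed

lemma metric_has_derivative:
  assumes A: "horizontal_lift V A" and B: "horizontal_lift W B" and X: "(X :: real^'d^'n) \<in> gram_domain"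
    and d: "A differentiable (at X)" "B differentiable (at X)"
  shows "((\<lambda>X. rq.metric (gram X) (V (gram X)) (W (gram X))) has_derivative
      (\<lambda>h. inner (A X) (FD B X h) + inner (FD A X h) (B X))) (at X)"
proof -
  have "((\<lambda>X. inner (A X) (B X)) has_derivative (\<lambda>h. inner (A X) (FD B X h) + inner (FD A X h) (B X))) (at X)"
    using d by (intro has_derivative_inner FD_works)
  then show ?thesis
    by (rule has_derivative_transform_within_open [OF _ open_gram_domain X]) (simp add: metric_lift [OF A B])
qed

text \<open>Differentiating \<open>dgram X (B X)\<close> along \<open>A X\<close> also produces
  \<open>dgram (A X) (B X)\<close>, which is symmetric in the two lifts and cancels in the
  bracket.\<close>

lemma bracket_lift:
  assumes A: "horizontal_lift V A" and B: "horizontal_lift W B" and X: "(X :: real^'d^'n) \<in> gram_domain"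
    and d: "A differentiable (at X)" "B differentiable (at X)"
  shows "rq.bracket V W (gram X) = dgram X (FD B X (A X) - FD A X (B X))"
proof -
  have "rq.deriv_along W (gram X) (V (gram X)) = dgram X (FD B X (A X)) + dgram (A X) (B X)"
    unfolding horizontal_liftD(2) [OF A X]
    by (rule deriv_along_dgram [OF X field_has_derivative [OF B X d(2)]])
  moreover have "rq.deriv_along V (gram X) (W (gram X)) = dgram X (FD A X (B X)) + dgram (B X) (A X)"
    unfolding horizontal_liftD(2) [OF B X]
    by (rule deriv_along_dgram [OF X field_has_derivative [OF A X d(1)]])
  ultimately show ?thesis
    by (simp add: rq.bracket_def dgram_commute [of "B X"] linear_diff [OF linear_dgram])
qed

lemma metric_bracket:
  assumes A: "horizontal_lift V A" and B: "horizontal_lift W B" and C: "horizontal_lift Z C"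
    and X: "(X :: real^'d^'n) \<in> gram_domain" and d: "A differentiable (at X)" "B differentiable (at X)"
  shows "rq.metric (gram X) (rq.bracket V W (gram X)) (Z (gram X)) = inner (FD B X (A X) - FD A X (B X)) (C X)"
  unfolding bracket_lift [OF A B X d] horizontal_liftD(2) [OF C X] metric_dgram [OF X]
  by (simp add: inner_hlift hlift_eq horizontal_liftD(1) [OF C X])

text \<open>Each of the six terms equals its flat counterpart for the lifts: brackets occur only
  paired with horizontal vectors, so their projection drops out. The sum then collapses as in
  Euclidean space.\<close>

lemma koszul_lift:
  assumes A: "horizontal_lift V A" and B: "horizontal_lift W B" and C: "horizontal_lift Z C"
    and X: "(X :: real^'d^'n) \<in> gram_domain"
    and d: "A differentiable (at X)" "B differentiable (at X)" "C differentiable (at X)"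
  shows "rq.koszul V W Z (gram X) = 2 * inner (FD B X (A X)) (C X)"
proof -
  have dm: "rq.deriv_along (\<lambda>q. rq.metric q (V1 q) (V2 q)) (gram X) (V3 (gram X))
      = inner (A1 X) (FD A2 X (A3 X)) + inner (FD A1 X (A3 X)) (A2 X)"
    if "horizontal_lift V1 A1" "horizontal_lift V2 A2" "horizontal_lift V3 A3"
      "A1 differentiable (at X)" "A2 differentiable (at X)" for V1 V2 V3 A1 A2 A3
    unfolding horizontal_liftD(2) [OF that(3) X]
    by (rule deriv_along_dgram [OF X metric_has_derivative [OF that(1,2) X that(4,5)]])
  show ?thesis
    unfolding rq.koszul_def dm [OF B C A d(2,3)] dm [OF A C B d(1,3)] dm [OF A B C d(1,2)]
      metric_bracket [OF A B C X d(1,2)] metric_bracket [OF A C B X d(1,3)] metric_bracket [OF B C A X d(2,3)]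
    by (simp add: inner_diff inner_commute)
qed

text \<open>Existence is \<open>koszul_lift\<close> against lifts of arbitrary fields. For
  uniqueness, the difference \<open>H - K\<close> of the lifts of two candidates is the value at
  \<open>X\<close> of the lift of some \<open>sym_field S\<close>; testing with this field gives
  \<open>inner (H - K) (H - K) = 0\<close>. \<open>V\<close> and \<open>W\<close> only need lifts
  differentiable at \<open>X\<close>, so the formula can be iterated in the curvature.\<close>

lemma nabla_lift:
  assumes A: "horizontal_lift V A" and B: "horizontal_lift W B" and X: "(X :: real^'d^'n) \<in> gram_domain"
    and d: "A differentiable (at X)" "B differentiable (at X)"
  shows "rq.nabla V W (gram X) = dgram X (FD B X (A X))"
  unfolding rq.nabla_def
proof (rule the_equality)
  let ?u = "FD B X (A X)"
  show "dgram X ?u \<in> rq.tangent (gram X) \<and>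
      (\<forall>Z\<in>rq.vector_fields. 2 * rq.metric (gram X) (dgram X ?u) (Z (gram X)) = rq.koszul V W Z (gram X))"
  proof (intro conjI ballI)
    show "dgram X ?u \<in> rq.tangent (gram X)" by (simp add: rq_tangent [OF X])
    fix Z assume "Z \<in> rq.vector_fields"
    then obtain C :: "real^'d^'n \<Rightarrow> real^'d^'n" where C: "horizontal_lift Z C" "twice_differentiable_on C gram_domain"
      by (rule vector_field_lift)
    show "2 * rq.metric (gram X) (dgram X ?u) (Z (gram X)) = rq.koszul V W Z (gram X)"
      unfolding koszul_lift [OF A B C(1) X d twice_differentiable_onD(1) [OF C(2) X]]
        horizontal_liftD(2) [OF C(1) X] metric_dgram [OF X]
      by (simp add: inner_hlift hlift_eq horizontal_liftD(1) [OF C(1) X])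
  qed
  fix z assume z: "z \<in> rq.tangent (gram X) \<and>
      (\<forall>Z\<in>rq.vector_fields. 2 * rq.metric (gram X) z (Z (gram X)) = rq.koszul V W Z (gram X))"
  then obtain c where c: "z = dgram X c" using rq_tangent [OF X] by auto
  define H where "H = rq.hlift X z"
  define K where "K = rq.hlift X (dgram X ?u)"
  have H: "H \<in> rq.horizontal X" "dgram X H = z" and K: "K \<in> rq.horizontal X" "dgram X K = dgram X ?u"
    using hlift_horizontal dgram_hlift by (auto simp: H_def K_def c)
  have "H - K \<in> rq.horizontal X" using H K subspace_diff subspace_horizontal by blast
  then obtain S where S: "symmetric_matrix S" "H - K = S ** X"
    using horizontal_eq_symmetric_mult [OF X] mem_horizontal_iff [OF X] by blast
  note C = horizontal_lift_sym_field [OF S(1)]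
  have "(\<lambda>X. S ** X) differentiable (at X)"
    using bounded_linear_imp_differentiable bounded_bilinear.bounded_linear_right [OF bounded_bilinear_matrix_mult]
    by blast
  then have "rq.koszul V W (sym_field S) (gram X) = 2 * inner ?u (H - K)"
    unfolding S(2) by (rule koszul_lift [OF A B C X d])
  moreover have "inner ?u (H - K) = inner K (H - K)"
    unfolding K_def using \<open>H - K \<in> rq.horizontal X\<close> by (simp add: inner_hlift K_def)
  moreover have "rq.metric (gram X) z (sym_field S (gram X)) = inner H (H - K)"
    unfolding c sym_field_gram [OF S(1)] metric_dgram [OF X] S(2) [symmetric]
    using hlift_eq [OF \<open>H - K \<in> rq.horizontal X\<close>] by (simp add: H_def c)
  ultimately have "inner (H - K) (H - K) = 0"
    using z sym_field_vector_field [OF S(1)] by (auto simp: inner_diff_left)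
  then show "z = dgram X ?u" using H(2) K(2) by simp
qed

section \<open>The curvature of commuting horizontal directions\<close>

text \<open>Where \<open>A\<^sup>T B\<close> is symmetric, the flat derivatives of the lifts \<open>A\<close> and \<open>B\<close> along each other are
  horizontal, because \<open>X\<^sup>T B\<close> is symmetric throughout. Thus O'Neill's vertical terms vanish and the flat
  curvature remains.\<close>

lemma horizontal_derivative:
  assumes B: "horizontal_lift W B" and X: "(X :: real^'d^'n) \<in> gram_domain" and d: "B differentiable (at X)"
    and u: "symmetric_matrix (transpose u ** B X)"
  shows "FD B X u \<in> rq.horizontal X"
proof -
  have t: "((\<lambda>X. transpose X) has_derivative transpose) (at X)"
    by (rule bounded_linear_imp_has_derivative [OF bounded_linear_transpose])
  have "((\<lambda>X. transpose X ** B X) has_derivative (\<lambda>h. transpose X ** FD B X h + transpose h ** B X)) (at X)"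
    by (intro bounded_bilinear.FDERIV [OF bounded_bilinear_matrix_mult] t FD_works d)
  then have 1: "((\<lambda>X. transpose (transpose X ** B X)) has_derivative
      (\<lambda>h. transpose (transpose X ** FD B X h + transpose h ** B X))) (at X)"
    by (rule bounded_linear.has_derivative [OF bounded_linear_transpose])
  have "((\<lambda>X. transpose X ** B X) has_derivative
      (\<lambda>h. transpose (transpose X ** FD B X h + transpose h ** B X))) (at X)"
    by (rule has_derivative_transform_within_open [OF 1 open_gram_domain X])
      (use B in \<open>simp add: horizontal_lift_def symmetric_matrix_def\<close>)
  then have "(\<lambda>h. transpose X ** FD B X h + transpose h ** B X)
      = (\<lambda>h. transpose (transpose X ** FD B X h + transpose h ** B X))"
    by (rule has_derivative_unique [OF \<open>((\<lambda>X. transpose X ** B X) has_derivative (\<lambda>h. transpose X ** FD B X h + transpose h ** B X)) (at X)\<close>])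
  from fun_cong [OF this, of u] show ?thesis
    using u by (simp add: mem_horizontal_iff [OF X] symmetric_matrix_def transpose_add)
qed

text \<open>The products of \<open>a\<close> and of its projection with \<open>A\<close> agree on
  the whole domain, hence so do their derivatives. Where \<open>a X\<close> is horizontal it equals
  its projection, and the terms containing \<open>FD A X\<close> cancel.\<close>

lemma inner_FD_hlift:
  fixes a :: "real^'d^'n \<Rightarrow> real^'d^'n"
  assumes A: "horizontal_lift V A" and X: "X \<in> gram_domain" and d: "A differentiable (at X)"
    and a: "a differentiable (at X)" and hor: "a X \<in> rq.horizontal X"
  shows "inner (FD (\<lambda>X. rq.hlift X (dgram X (a X))) X u) (A X) = inner (FD a X u) (A X)"
proof -
  let ?l = "\<lambda>X. rq.hlift X (dgram X (a X))"
  have 1: "((\<lambda>X. inner (a X) (A X)) has_derivative (\<lambda>h. inner (a X) (FD A X h) + inner (FD a X h) (A X))) (at X)"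
    using d a by (intro has_derivative_inner FD_works)
  have 2: "((\<lambda>X. inner (?l X) (A X)) has_derivative (\<lambda>h. inner (?l X) (FD A X h) + inner (FD ?l X h) (A X))) (at X)"
    using d hlift_differentiable [OF X a] by (intro has_derivative_inner FD_works)
  have "((\<lambda>X. inner (?l X) (A X)) has_derivative (\<lambda>h. inner (a X) (FD A X h) + inner (FD a X h) (A X))) (at X)"
    by (rule has_derivative_transform_within_open [OF 1 open_gram_domain X])
      (simp add: inner_hlift horizontal_liftD [OF A])
  from fun_cong [OF has_derivative_unique [OF 2 this], of u] show ?thesis
    by (simp add: hlift_eq [OF hor])
qed

lemma curvature_eq_0:
  assumes V: "V \<in> rq.vector_fields" and W: "W \<in> rq.vector_fields" and X: "(X :: real^'d^'n) \<in> gram_domain"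
    and sym: "symmetric_matrix (transpose (rq.hlift X (V (gram X))) ** rq.hlift X (W (gram X)))"
  shows "rq.metric (gram X) (rq.curvature V W W (gram X)) (V (gram X)) = 0"
proof -
  let ?E = "gram_domain :: (real^'d^'n) set"
  obtain A where A: "horizontal_lift V A" "twice_differentiable_on A ?E" by (rule vector_field_lift [OF V])
  obtain B where B: "horizontal_lift W B" "twice_differentiable_on B ?E" by (rule vector_field_lift [OF W])
  note dA = twice_differentiable_onD(1) [OF A(2)] and dB = twice_differentiable_onD(1) [OF B(2)]
  have symAB: "symmetric_matrix (transpose (A X) ** B X)"
    using sym unfolding horizontal_liftD(3) [OF A(1) X] horizontal_liftD(3) [OF B(1) X] .
  then have symBA: "symmetric_matrix (transpose (B X) ** A X)"
    unfolding symmetric_matrix_def by (metis matrix_transpose_mul transpose_transpose)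
  have symBB: "symmetric_matrix (transpose (B X) ** B X)"
    by (simp add: symmetric_matrix_def matrix_transpose_mul)
  let ?a1 = "\<lambda>Y. FD B Y (B Y)" and ?a2 = "\<lambda>Y. FD B Y (A Y)" and ?a3 = "\<lambda>Y. FD B Y (A Y) - FD A Y (B Y)"
  let ?l = "\<lambda>a Y. rq.hlift Y (dgram Y (a Y))"
  have D1: "(?a1 has_derivative (\<lambda>h. FD (\<lambda>y. FD B y (B Y)) Y h + FD B Y (FD B Y h))) (at Y)"
    and D2: "(?a2 has_derivative (\<lambda>h. FD (\<lambda>y. FD B y (A Y)) Y h + FD B Y (FD A Y h))) (at Y)"
    and D3: "((\<lambda>Y. FD A Y (B Y)) has_derivative (\<lambda>h. FD (\<lambda>y. FD A y (B Y)) Y h + FD A Y (FD B Y h))) (at Y)"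
    if "Y \<in> ?E" for Y
    using that by (auto intro!: has_derivative_FD_apply [OF open_gram_domain] A B FD_works dA dB)
  have d1: "?a1 differentiable (at Y)" and d2: "?a2 differentiable (at Y)" and d3: "?a3 differentiable (at Y)"
    if "Y \<in> ?E" for Y
    using D1 [OF that] D2 [OF that] D3 [OF that] by (auto simp: differentiable_def intro: has_derivative_diff)
  \<comment> \<open>Away from \<open>X\<close> the derivatives \<open>?a1\<close>,
    \<open>?a2\<close> and \<open>?a3\<close> need not be horizontal, so these fields are lifted by
    the projections \<open>?l\<close>.\<close>
  have L1: "horizontal_lift (rq.nabla W W) (?l ?a1)"
    by (intro horizontal_lift_hlift nabla_lift B(1) dB)
  have L2: "horizontal_lift (rq.nabla V W) (?l ?a2)"
    by (intro horizontal_lift_hlift nabla_lift A(1) B(1) dA dB)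
  have L3: "horizontal_lift (rq.bracket V W) (?l ?a3)"
    by (intro horizontal_lift_hlift bracket_lift A(1) B(1) dA dB)
  have h1: "?a1 X \<in> rq.horizontal X" by (rule horizontal_derivative [OF B(1) X dB [OF X] symBB])
  have h2: "?a2 X \<in> rq.horizontal X" by (rule horizontal_derivative [OF B(1) X dB [OF X] symAB])
  have h2': "FD A X (B X) \<in> rq.horizontal X" by (rule horizontal_derivative [OF A(1) X dA [OF X] symBA])
  have h3: "?a3 X \<in> rq.horizontal X" using h2 h2' subspace_diff subspace_horizontal by blast
  have "rq.curvature V W W (gram X)
     = dgram X (FD (?l ?a1) X (A X)) - dgram X (FD (?l ?a2) X (B X)) - dgram X (FD B X (?l ?a3 X))"
    unfolding rq.curvature_def
    using nabla_lift [OF A(1) L1 X dA [OF X] hlift_differentiable [OF X d1 [OF X]]]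
      nabla_lift [OF B(1) L2 X dB [OF X] hlift_differentiable [OF X d2 [OF X]]]
      nabla_lift [OF L3 B(1) X hlift_differentiable [OF X d3 [OF X]] dB [OF X]] by simp
  also have "\<dots> = dgram X (FD (?l ?a1) X (A X) - FD (?l ?a2) X (B X) - FD B X (?a3 X))"
    unfolding hlift_eq [OF h3] by (simp add: linear_diff [OF linear_dgram])
  finally have "rq.metric (gram X) (rq.curvature V W W (gram X)) (V (gram X))
     = inner (FD (?l ?a1) X (A X) - FD (?l ?a2) X (B X) - FD B X (?a3 X)) (A X)"
    unfolding horizontal_liftD(2) [OF A(1) X]
    by (simp add: metric_dgram [OF X] inner_hlift hlift_eq horizontal_liftD(1) [OF A(1) X])
  also have "\<dots> = inner (FD ?a1 X (A X) - FD ?a2 X (B X) - FD B X (?a3 X)) (A X)"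
    using inner_FD_hlift [OF A(1) X dA [OF X] d1 [OF X] h1] inner_FD_hlift [OF A(1) X dA [OF X] d2 [OF X] h2]
    by (simp add: inner_diff_left)
  \<comment> \<open>This is the flat curvature: the second derivatives of \<open>B\<close> cancel by
    symmetry, and the remaining \<open>FD B X (FD B X (A X)) - FD B X (FD A X (B X))\<close> is the
    bracket term.\<close>
  also have "FD ?a1 X (A X) - FD ?a2 X (B X) - FD B X (?a3 X) = 0"
    using symmetric_second_derivative [OF open_gram_domain X B(2), of "A X" "B X"]
    by (simp add: FD_eq [OF D1 [OF X]] FD_eq [OF D2 [OF X]] linear_diff [OF FD_linear [OF dB [OF X]]])
  finally show ?thesis by simp
qed

text \<open>The description ranges over all pairs of fields spanning the plane, so
  \<open>sym\<close> is shown for any two of its vectors: their lifts are \<open>M ** X\<close> with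
  \<open>M\<close> in the span of \<open>S\<close> and \<open>T\<close>, and products of such
  commuting symmetric \<open>M\<close> are symmetric. The value is pinned down by one actual pair,
  \<open>sym_field S\<close> and \<open>sym_field T\<close>.\<close>

theorem sectional_curvature_commuting:
  assumes X: "(X :: real^'d^'n) \<in> gram_domain" and S: "symmetric_matrix S" "symmetric_matrix T" "S ** T = T ** S"
    and v: "v = dgram X (S ** X)" and w: "w = dgram X (T ** X)" and vw: "v \<noteq> w" "independent {v, w}"
  shows "rq.sectional_curvature (gram X) (span {v, w}) = 0"
  unfolding rq.sectional_curvature_def
proof (rule the_equality)
  have lift: "\<exists>a b. rq.hlift X u = (a *\<^sub>R S + b *\<^sub>R T) ** X" if uvw: "u \<in> span {v, w}" for u
  proof -
    obtain a where "u - a *\<^sub>R v \<in> span {w}" using uvw unfolding span_breakdown_eq [of u v] by blast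
    then obtain b where "u - a *\<^sub>R v = b *\<^sub>R w" by (auto simp: span_singleton)
    then have "u = a *\<^sub>R v + b *\<^sub>R w" by (simp add: diff_eq_eq add.commute)
    then have u: "u = dgram X ((a *\<^sub>R S + b *\<^sub>R T) ** X)"
      by (simp add: v w matrix_algebra linear_add [OF linear_dgram] linear_cmul [OF linear_dgram])
    have "symmetric_matrix (a *\<^sub>R S + b *\<^sub>R T)" using S by (simp add: symmetric_matrix_def transpose_add transpose_scalar)
    then have "(a *\<^sub>R S + b *\<^sub>R T) ** X \<in> rq.horizontal X"
      by (simp add: mem_horizontal_iff [OF X] horizontal_sym_field)
    from hlift_eq [OF this] show ?thesis unfolding u by blast
  qed
  have sym: "symmetric_matrix (transpose (rq.hlift X u) ** rq.hlift X u')"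
    if uu: "u \<in> span {v, w}" "u' \<in> span {v, w}" for u u'
  proof -
    obtain a b where 1: "rq.hlift X u = (a *\<^sub>R S + b *\<^sub>R T) ** X" using lift uu(1) by blast
    obtain c d where 2: "rq.hlift X u' = (c *\<^sub>R S + d *\<^sub>R T) ** X" using lift uu(2) by blast
    let ?M = "(a *\<^sub>R S + b *\<^sub>R T) ** (c *\<^sub>R S + d *\<^sub>R T)"
    have st: "transpose S = S" "transpose T = T" using S by (auto simp: symmetric_matrix_def)
    have "symmetric_matrix ?M"
      using S(3) by (simp add: symmetric_matrix_def matrix_algebra st add_ac mult.commute)
    then show ?thesis unfolding 1 2
      using horizontal_sym_field [of ?M X] by (simp add: matrix_algebra st)
  qed
  show "\<forall>V\<in>rq.vector_fields. \<forall>W\<in>rq.vector_fields.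
       V (gram X) \<noteq> W (gram X) \<and> independent {V (gram X), W (gram X)} \<and> span {V (gram X), W (gram X)} = span {v, w} \<longrightarrow>
       0 = rq.metric (gram X) (rq.curvature V W W (gram X)) (V (gram X)) /
           (rq.metric (gram X) (V (gram X)) (V (gram X)) * rq.metric (gram X) (W (gram X)) (W (gram X)) -
            (rq.metric (gram X) (V (gram X)) (W (gram X)))\<^sup>2)"
  proof (intro ballI impI, elim conjE)
    fix V W assume VW: "V \<in> rq.vector_fields" "W \<in> rq.vector_fields"
      and span: "span {V (gram X), W (gram X)} = span {v, w}"
    have "V (gram X) \<in> span {v, w}" "W (gram X) \<in> span {v, w}"
      unfolding span [symmetric] by (auto intro: span_base)
    from curvature_eq_0 [OF VW X sym [OF this]]
    show "0 = rq.metric (gram X) (rq.curvature V W W (gram X)) (V (gram X)) /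
           (rq.metric (gram X) (V (gram X)) (V (gram X)) * rq.metric (gram X) (W (gram X)) (W (gram X)) -
            (rq.metric (gram X) (V (gram X)) (W (gram X)))\<^sup>2)" by simp
  qed
  then have 0: "V (gram X) = v \<Longrightarrow> W (gram X) = w \<Longrightarrow> V \<in> rq.vector_fields \<Longrightarrow> W \<in> rq.vector_fields \<Longrightarrow>
      0 = rq.metric (gram X) (rq.curvature V W W (gram X)) (V (gram X)) /
           (rq.metric (gram X) (V (gram X)) (V (gram X)) * rq.metric (gram X) (W (gram X)) (W (gram X)) -
            (rq.metric (gram X) (V (gram X)) (W (gram X)))\<^sup>2)" for V W
    using vw by metis
  fix k assume "\<forall>V\<in>rq.vector_fields. \<forall>W\<in>rq.vector_fields.
       V (gram X) \<noteq> W (gram X) \<and> independent {V (gram X), W (gram X)} \<and> span {V (gram X), W (gram X)} = span {v, w} \<longrightarrow>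
       k = rq.metric (gram X) (rq.curvature V W W (gram X)) (V (gram X)) /
           (rq.metric (gram X) (V (gram X)) (V (gram X)) * rq.metric (gram X) (W (gram X)) (W (gram X)) -
            (rq.metric (gram X) (V (gram X)) (W (gram X)))\<^sup>2)"
  from bspec [OF bspec [OF this sym_field_vector_field [OF S(1)]] sym_field_vector_field [OF S(2)]]
  show "k = 0"
    using 0 [of "sym_field S" "sym_field T"] vw
    by (simp add: sym_field_gram S(1,2) v w sym_field_vector_field)
qed

end

section \<open>The spectrum of a symmetric matrix\<close>

definition orthonormal_family :: "('n \<Rightarrow> real^'n) \<Rightarrow> bool" where
  "orthonormal_family b \<longleftrightarrow> (\<forall>i j. inner (b i) (b j) = (if i = j then 1 else 0))"

lemma symmetric_matrix_inner:
  assumes "symmetric_matrix A" shows "inner (A *v x) y = inner x (A *v y)"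
  using assms dot_lmul_matrix [of y A x] unfolding symmetric_matrix_def
  by (metis dot_lmul_matrix transpose_matrix_vector)

text \<open>A maximizer of the Rayleigh quotient on an invariant subspace is an eigenvector.\<close>

lemma symmetric_eigenvector_in_subspace:
  fixes A :: "real^'n^'n"
  assumes A: "symmetric_matrix A" and S: "subspace S" "S \<noteq> {0}" and inv: "\<And>x. x \<in> S \<Longrightarrow> A *v x \<in> S"
  obtains x c where "x \<in> S" "norm x = 1" "A *v x = c *\<^sub>R x"
proof -
  let ?f = "\<lambda>x. inner x (A *v x)"
  have "compact (sphere 0 1 \<inter> S)" by (intro compact_Int_closed compact_sphere closed_subspace S)
  moreover obtain z where z: "z \<in> S" "z \<noteq> 0" using S subspace_0 by blast
  then have "z /\<^sub>R norm z \<in> sphere 0 1 \<inter> S" using S(1) by (auto simp: subspace_mul)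
  moreover have "continuous_on (sphere 0 1 \<inter> S) ?f"
    by (intro continuous_intros linear_continuous_on matrix_vector_mul_bounded_linear)
  ultimately obtain x where x: "x \<in> sphere 0 1 \<inter> S" "\<And>y. y \<in> sphere 0 1 \<inter> S \<Longrightarrow> ?f y \<le> ?f x"
    using continuous_attains_sup [of "sphere 0 1 \<inter> S" ?f] by blast
  define c where "c = ?f x"
  have le: "?f y \<le> c * inner y y" if "y \<in> S" for y
  proof (cases "y = 0")
    case False
    then have "y /\<^sub>R norm y \<in> sphere 0 1 \<inter> S" using that S(1) by (auto simp: subspace_mul)
    from x(2) [OF this] have "?f y / (norm y * norm y) \<le> c"
      by (simp add: c_def matrix_vector_mult_scaleR field_simps)
    then show ?thesis using False by (simp add: field_simps dot_square_norm power2_eq_square)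
  qed simp
  \<comment> \<open>Half the gradient at \<open>x\<close> of \<open>c * inner y y - ?f y\<close>, a
    form that is nonnegative on \<open>S\<close> and vanishes at \<open>x\<close>;
    \<open>quad\<close> evaluates it at \<open>x + s *\<^sub>R h\<close>.\<close>
  define h where "h = c *\<^sub>R x - A *v x"
  have h: "h \<in> S" using x(1) inv S(1) by (simp add: h_def subspace_diff subspace_mul)
  define k where "k = c * inner h h - ?f h"
  have quad: "0 \<le> 2 * s * inner h h + s\<^sup>2 * k" for s
  proof -
    have xx: "inner x x = 1" using x(1) by (simp add: dot_square_norm)
    have Ah: "inner x (A *v h) = inner h (A *v x)"
      using symmetric_matrix_inner [OF A, of x h] by (simp add: inner_commute)
    have "inner h h = inner h (c *\<^sub>R x - A *v x)" by (simp add: h_def)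
    then have hh: "inner h h = c * inner x h - inner h (A *v x)"
      by (simp add: inner_diff_right inner_commute)
    have "x + s *\<^sub>R h \<in> S" using x(1) h S(1) by (simp add: subspace_add subspace_mul)
    from le [OF this] have "?f (x + s *\<^sub>R h) \<le> c * inner (x + s *\<^sub>R h) (x + s *\<^sub>R h)" .
    moreover have "?f (x + s *\<^sub>R h) = c + 2 * s * inner h (A *v x) + s\<^sup>2 * ?f h"
      by (simp add: matrix_vector_right_distrib matrix_vector_mult_scaleR inner_add_left inner_add_right Ah c_def
          power2_eq_square algebra_simps)
    moreover have "c * inner (x + s *\<^sub>R h) (x + s *\<^sub>R h) = c + 2 * s * (c * inner x h) + s\<^sup>2 * (c * inner h h)"
      by (simp add: inner_add_left inner_add_right xx inner_commute [of h x] power2_eq_square algebra_simps)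
    ultimately show ?thesis unfolding hh k_def by (simp add: algebra_simps)
  qed
  have "inner h h = 0"
  proof (rule ccontr)
    assume "inner h h \<noteq> 0"
    then have p: "inner h h > 0" using inner_ge_zero [of h] by linarith
    \<comment> \<open>Small enough for \<open>s * k \<le> inner h h\<close>, so that at
      \<open>- s\<close> the linear term of \<open>quad\<close> outweighs the quadratic one and the
      form becomes negative.\<close>
    define s where "s = inner h h / (\<bar>k\<bar> + 1)"
    have s: "s > 0" using p by (simp add: s_def)
    have "s * k \<le> s * (\<bar>k\<bar> + 1)" using s by (intro mult_left_mono) auto
    then have "s * k \<le> inner h h" by (simp add: s_def)
    then have "2 * inner h h - s * k > 0" using p by linarith
    then have "s * (2 * inner h h - s * k) > 0" using s by simp
    with quad [of "- s"] show False by (simp add: power2_eq_square algebra_simps)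
  qed
  then have "A *v x = c *\<^sub>R x" by (simp add: h_def)
  with x(1) that show ?thesis by auto
qed

text \<open>Take an orthonormal set of eigenvectors of maximal size. Its orthogonal complement is
  invariant because \<open>A\<close> is symmetric, so if nonzero it would contribute another unit
  eigenvector.\<close>

theorem symmetric_orthonormal_eigenbasis:
  fixes A :: "real^'n^'n"
  assumes A: "symmetric_matrix A"
  obtains b m where "orthonormal_family b" "\<And>i. A *v b i = m i *\<^sub>R b i"
proof -
  let ?Q = "\<lambda>B. pairwise orthogonal B \<and> (\<forall>x\<in>B. norm x = 1 \<and> (\<exists>c. A *v x = c *\<^sub>R x))"
  have indep: "independent B" if "?Q B" for B
    using that by (intro pairwise_orthogonal_independent) auto
  have "\<forall>B. ?Q B \<longrightarrow> card B < Suc CARD('n)"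
    using indep independent_card_le by (metis DIM_cart DIM_real One_nat_def le_imp_less_Suc mult.right_neutral)
  moreover have "?Q {}" by simp
  ultimately obtain B where B: "?Q B" "\<And>B'. ?Q B' \<Longrightarrow> card B' \<le> card B"
    using ex_has_greatest_nat [of ?Q "{}" card "Suc CARD('n)"] by blast
  have fin: "finite B" using indep [OF B(1)] independent_imp_finite by blast
  have span: "span B = UNIV"
  proof (rule ccontr)
    assume "span B \<noteq> UNIV"
    then obtain a where a: "a \<noteq> 0" "\<forall>x\<in>span B. inner a x = 0" using span_not_UNIV_orthogonal by blast
    define S where "S = {y. \<forall>x\<in>B. inner x y = 0}"
    have S: "subspace S" by (auto simp: S_def subspace_def inner_add_right)
    have "a \<in> S" using a(2) by (auto simp: S_def inner_commute span_base)
    then have "S \<noteq> {0}" using a(1) by blast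
    moreover have "A *v y \<in> S" if "y \<in> S" for y
      unfolding S_def
    proof (intro CollectI ballI)
      fix x assume x: "x \<in> B"
      then obtain c where "A *v x = c *\<^sub>R x" using B(1) by blast
      then show "inner x (A *v y) = 0"
        using that x symmetric_matrix_inner [OF A, of x y] by (simp add: S_def)
    qed
    ultimately obtain x c where x: "x \<in> S" "norm x = 1" "A *v x = c *\<^sub>R x"
      using symmetric_eigenvector_in_subspace [OF A S] by metis
    have "x \<notin> B" using x(1,2) by (auto simp: S_def dot_square_norm)
    moreover have "?Q (insert x B)"
      using B(1) x by (auto simp: pairwise_insert S_def orthogonal_def inner_commute)
    ultimately show False using B(2) [of "insert x B"] fin by simp
  qed
  have "card B = CARD('n)"
    using basis_card_eq_dim [of B UNIV] indep [OF B(1)] span by simp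
  then obtain b :: "'n \<Rightarrow> real^'n" where b: "bij_betw b UNIV B"
    using finite_same_card_bij [of "UNIV :: 'n set" B] fin by auto
  have bB: "b i \<in> B" for i using b by (auto simp: bij_betw_def)
  have "orthonormal_family b"
    unfolding orthonormal_family_def
  proof (intro allI)
    fix i j
    show "inner (b i) (b j) = (if i = j then 1 else 0)"
      using B(1) bB [of i] bB [of j] b
      by (auto simp: bij_betw_def inj_eq dot_square_norm pairwise_def orthogonal_def)
  qed
  moreover have "\<forall>i. \<exists>c. A *v b i = c *\<^sub>R b i" using B(1) bB by blast
  ultimately show ?thesis using that by metis
qed

section \<open>Characteristic polynomial and ranked eigenvalues from an eigenbasis\<close>

context
  fixes b :: "'n \<Rightarrow> real^'n"
  assumes b: "orthonormal_family b"
begin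

lemma orthonormal_family_matrix: "orthogonal_matrix (\<chi> i. b i)"
proof -
  have "(\<chi> i. b i) ** transpose (\<chi> i. b i) = mat 1"
    using b by (simp add: matrix_mult_transpose_dot_row row_def orthonormal_family_def mat_def vec_eq_iff
        vec_lambda_eta)
  then show ?thesis by (metis orthogonal_matrix_def matrix_left_right_inverse)
qed

lemma orthonormal_expand: "(\<Sum>i\<in>UNIV. inner x (b i) *\<^sub>R b i) = x"
proof -
  let ?Q = "\<chi> i. b i"
  have "x = transpose ?Q *v (?Q *v x)"
    using orthonormal_family_matrix by (simp add: orthogonal_matrix_def matrix_vector_mul_assoc del: transpose_matrix_vector)
  also have "transpose ?Q *v y = (\<Sum>i\<in>UNIV. y $ i *\<^sub>R b i)" for y
    by (simp add: matrix_mult_sum row_def vec_lambda_eta scalar_mult_eq_scaleR del: transpose_matrix_vector)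
  also have "(\<Sum>i\<in>UNIV. (?Q *v x) $ i *\<^sub>R b i) = (\<Sum>i\<in>UNIV. inner x (b i) *\<^sub>R b i)"
    by (simp add: matrix_mult_dot inner_commute)
  finally show ?thesis by simp
qed

lemma orthonormal_matrix_eqI:
  assumes "\<And>i. A *v b i = B *v b i" shows "A = (B :: real^'n^'m)"
proof -
  have "A *v x = B *v x" for x
  proof -
    have "M *v x = (\<Sum>i\<in>UNIV. inner x (b i) *\<^sub>R (M *v b i))" for M :: "real^'n^'m"
      by (subst orthonormal_expand [of x, symmetric])
        (simp add: linear_sum [OF matrix_vector_mul_linear] matrix_vector_mult_scaleR)
    then show ?thesis by (simp add: assms)
  qed
  then show ?thesis by (simp add: matrix_eq)
qed

lemma poly_charpoly: "poly (charpoly A) x = det (x *\<^sub>R mat 1 - A)" for A :: "real^'n^'n"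
  unfolding charpoly_def det_def
  by (simp add: poly_sum poly_prod mat_def of_int_poly if_distrib [where f = "\<lambda>p. poly p x"] cong: if_cong)
    (intro sum.cong refl arg_cong2 [where f = times] prod.cong, auto simp: sign_def)

text \<open>Real polynomials are determined by their values, so it suffices to diagonalize
  \<open>x *\<^sub>R mat 1 - A\<close> for each number \<open>x\<close>, using the orthogonal matrix
  with rows \<open>b i\<close>.\<close>

lemma charpoly_eigenbasis:
  fixes A :: "real^'n^'n"
  assumes m: "\<And>i. A *v b i = m i *\<^sub>R b i"
  shows "charpoly A = (\<Prod>i\<in>UNIV. [:- m i, 1:])"
proof (rule poly_eq_poly_eq_iff [THEN iffD1], rule ext)
  fix x
  let ?Q = "\<chi> i. b i" and ?D = "\<chi> i j. if i = j then x - m i else (0 :: real)"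
  have Q: "transpose ?Q ** ?Q = mat 1" using orthonormal_family_matrix by (simp add: orthogonal_matrix_def)
  have "x *\<^sub>R mat 1 - A = transpose ?Q ** ?D ** ?Q"
  proof (rule orthonormal_matrix_eqI)
    fix k
    have "?Q *v b k = axis k 1"
      using b by (simp add: matrix_mult_dot vec_eq_iff axis_def orthonormal_family_def eq_commute)
    moreover have "?D *v axis k 1 = (x - m k) *\<^sub>R axis k 1"
      unfolding matrix_vector_mult_basis by (simp add: column_def vec_eq_iff axis_def)
    moreover have "transpose ?Q *v axis k 1 = b k"
      unfolding matrix_vector_mult_basis by (simp add: row_def vec_lambda_eta)
    ultimately have "(transpose ?Q ** ?D ** ?Q) *v b k = (x - m k) *\<^sub>R b k"
      by (simp add: matrix_vector_mul_assoc [symmetric] matrix_vector_mult_scaleR del: transpose_matrix_vector)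
    moreover have "(x *\<^sub>R mat 1 - A) *v b k = (x - m k) *\<^sub>R b k"
      by (simp add: matrix_vector_mult_diff_rdistrib scaleR_matrix_vector_assoc [symmetric] m scaleR_left_diff_distrib)
    ultimately show "(x *\<^sub>R mat 1 - A) *v b k = (transpose ?Q ** ?D ** ?Q) *v b k" by simp
  qed
  then have "poly (charpoly A) x = det (transpose ?Q ** ?D ** ?Q)" by (simp only: poly_charpoly)
  also have "\<dots> = det ?D * det (transpose ?Q ** ?Q)" by (simp add: det_mul)
  also have "\<dots> = (\<Prod>i\<in>UNIV. x - m i)" by (simp add: Q det_diagonal)
  finally show "poly (charpoly A) x = poly (\<Prod>i\<in>UNIV. [:- m i, 1:]) x" by (simp add: poly_prod)
qed

text \<open>\<open>map m ks\<close> is the ascending list inside \<open>nonzero_eigenvalue\<close>;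
  the reversal and the shift by one are those of that definition.\<close>

lemma nonzero_eigenvalue_eigenbasis:
  fixes A :: "real^'n^'n"
  assumes m: "\<And>i. A *v b i = m i *\<^sub>R b i"
    and ks: "set ks = {i. m i \<noteq> 0}" "distinct ks" "sorted (map m ks)"
    and \<iota>: "1 \<le> \<iota>" "\<iota> \<le> length ks"
  shows "nonzero_eigenvalue A \<iota> = m (rev ks ! (\<iota> - 1))"
proof -
  have "proots (charpoly A) = (\<Sum>i\<in>UNIV. {#m i#})"
    unfolding charpoly_eigenbasis [OF m] by (subst proots_prod) simp_all
  also have "\<dots> = image_mset m (mset_set UNIV)"
  proof -
    have "(\<Sum>i\<in>S. {#m i#}) = image_mset m (mset_set S)" if "finite S" for S
      using that by induction auto
    then show ?thesis by simp
  qed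
  finally have "filter_mset (\<lambda>x. x \<noteq> 0) (proots (charpoly A)) = image_mset m (mset_set {i. m i \<noteq> 0})"
    by (simp add: filter_mset_image_mset)
  also have "mset_set {i. m i \<noteq> 0} = mset ks" using ks(1,2) by (metis mset_set_set)
  finally have "sorted_list_of_multiset (filter_mset (\<lambda>x. x \<noteq> 0) (proots (charpoly A))) = map m ks"
    using ks(3) by (simp add: sorted_sort_id flip: mset_map)
  then show ?thesis using \<iota> by (simp add: nonzero_eigenvalue_def rev_map)
qed

end

text \<open>The vectors \<open>transpose X *v b i\<close> are orthogonal with squared norms
  \<open>m i\<close>, and they span since \<open>transpose X\<close> is surjective. So the nonzero
  ones form a basis of the d-dimensional space.\<close>

lemma card_nonzero_eigenvalues_gram:
  fixes X :: "real^'d^'n"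
  assumes b: "orthonormal_family b" and rank: "rank X = CARD('d)" and m: "\<And>i. gram X *v b i = m i *\<^sub>R b i"
  shows "card {i. m i \<noteq> 0} = CARD('d)"
proof -
  let ?J = "{i. m i \<noteq> 0}" and ?c = "\<lambda>i. transpose X *v b i"
  have cc: "inner (?c i) (?c j) = m j * (if i = j then 1 else 0)" for i j
  proof -
    have "inner (?c i) (?c j) = inner (b i) (gram X *v b j)"
      by (simp add: gram_def dot_lmul_matrix matrix_vector_mul_assoc [symmetric])
    then show ?thesis using b by (simp add: m orthonormal_family_def)
  qed
  have zero: "?c i = 0" if "m i = 0" for i using cc [of i i] that by (metis inner_eq_zero_iff mult_zero_left)
  have nz: "?c i \<noteq> 0" if "i \<in> ?J" for i
  proof
    assume "?c i = 0"
    then have "inner (?c i) (?c i) = 0" by simp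
    with cc [of i i] that show False by simp
  qed
  have inj: "inj_on ?c ?J"
  proof (rule inj_onI, rule ccontr)
    fix i j assume ij: "i \<in> ?J" "j \<in> ?J" "?c i = ?c j" "i \<noteq> j"
    then have "inner (?c i) (?c i) = 0" using cc [of i j] by simp
    then show False using nz [OF ij(1)] by simp
  qed
  have "independent (?c ` ?J)"
  proof (rule pairwise_orthogonal_independent)
    show "pairwise orthogonal (?c ` ?J)" by (auto simp: pairwise_def orthogonal_def cc simp del: transpose_matrix_vector)
    show "0 \<notin> ?c ` ?J" using nz by (auto simp del: transpose_matrix_vector)
  qed
  moreover have "span (?c ` ?J) = UNIV"
  proof -
    have surj: "surj ((*v) (transpose X))" using rank rank_transpose [of X] full_rank_surjective [of "transpose X"] by simp
    have "transpose X *v x \<in> span (?c ` ?J)" for x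
    proof -
      have "transpose X *v x = (\<Sum>i\<in>UNIV. inner x (b i) *\<^sub>R ?c i)"
        by (subst orthonormal_expand [OF b, of x, symmetric])
          (simp add: linear_sum [OF matrix_vector_mul_linear] matrix_vector_mult_scaleR del: transpose_matrix_vector)
      moreover have "inner x (b i) *\<^sub>R ?c i \<in> span (?c ` ?J)" for i
      proof (cases "m i = 0")
        case True
        then show ?thesis by (simp add: zero span_zero del: transpose_matrix_vector)
      next
        case False
        then have "?c i \<in> ?c ` ?J" by blast
        then have "?c i \<in> span (?c ` ?J)" by (rule span_base)
        then show ?thesis by (rule span_mul)
      qed
      ultimately show ?thesis by (simp add: span_sum)
    qed
    then have "range ((*v) (transpose X)) \<subseteq> span (?c ` ?J)" by blast
    with surj show ?thesis by (simp only: top.extremum_unique)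
  qed
  ultimately have "card (?c ` ?J) = CARD('d)" using basis_card_eq_dim [of "?c ` ?J" UNIV] by simp
  then show ?thesis unfolding card_image [OF inj] .
qed

section \<open>Uniqueness for ordinary differential equations\<close>

lemma has_vector_derivative_at_interior:
  assumes "(y has_vector_derivative y') (at t within I)" "{a<..<b} \<subseteq> I" "a < t" "t < b"
  shows "(y has_vector_derivative y') (at t)"
proof -
  have "at t within {a<..<b} = at t" using assms(3,4) by (intro at_within_open) auto
  then show ?thesis using has_vector_derivative_within_subset [OF assms(1,2)] by (simp only:)
qed

lemma interval_subset:
  fixes I :: "real set"
  assumes "is_interval I" "a \<in> I" "b \<in> I" shows "{a..b} \<subseteq> I"
  using mem_is_interval_1_I [OF assms] by auto

text \<open>A Gronwall argument: between \<open>t0\<close> and \<open>t\<close> the squared norm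
  satisfies \<open>|\<phi>'| \<le> 2 L \<phi>\<close>, so \<open>exp (- 2 L r) \<phi>\<close> is
  nonincreasing and \<open>exp (2 L r) \<phi>\<close> nondecreasing. Both are used, as
  \<open>t\<close> may lie on either side of \<open>t0\<close>. Stated as an inequality, it serves
  commutators, kernel vectors and differences of solutions alike.\<close>

lemma ode_eq_0:
  fixes y :: "real \<Rightarrow> 'a::real_inner"
  assumes I: "is_interval I" "t0 \<in> I" "y t0 = 0"
    and y: "\<And>t. t \<in> I \<Longrightarrow> (y has_vector_derivative y' t) (at t within I)"
    and l: "continuous_on I l" and bound: "\<And>t. t \<in> I \<Longrightarrow> norm (y' t) \<le> l t * norm (y t)"
    and t: "t \<in> I"
  shows "y t = 0"
proof -
  define a b where "a = min t0 t" and "b = max t0 t"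
  have ab: "a \<le> b" "{a..b} \<subseteq> I"
    using interval_subset [OF I(1) I(2) t] interval_subset [OF I(1) t I(2)] by (auto simp: a_def b_def min_def max_def)
  obtain s where "s \<in> {a..b}" "\<forall>r\<in>{a..b}. l r \<le> l s"
    using continuous_attains_sup [of "{a..b}" l] continuous_on_subset [OF l ab(2)] ab(1) by fastforce
  then obtain L where L: "\<And>r. r \<in> {a..b} \<Longrightarrow> l r \<le> L" by blast
  define \<phi> where "\<phi> = (\<lambda>r. inner (y r) (y r))"
  have \<phi>: "(\<phi> has_real_derivative 2 * inner (y r) (y' r)) (at r)" if r: "a < r" "r < b" for r
  proof -
    have "r \<in> I" using ab(2) r by auto
    moreover have "{a<..<b} \<subseteq> I" using ab(2) by auto
    ultimately have "(y has_vector_derivative y' r) (at r)"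
      using has_vector_derivative_at_interior y r by blast
    then have "(y has_derivative (\<lambda>h. h *\<^sub>R y' r)) (at r)" by (simp add: has_vector_derivative_def)
    from has_derivative_inner [OF this this]
    have "(\<phi> has_derivative (\<lambda>h. inner (y r) (h *\<^sub>R y' r) + inner (h *\<^sub>R y' r) (y r))) (at r)" by (simp add: \<phi>_def)
    then show ?thesis unfolding has_field_derivative_def
      by (rule has_derivative_eq_rhs) (simp add: fun_eq_iff inner_commute)
  qed
  have abs: "\<bar>2 * inner (y r) (y' r)\<bar> \<le> 2 * L * \<phi> r" if r: "a < r" "r < b" for r
  proof -
    have "\<bar>inner (y r) (y' r)\<bar> \<le> norm (y r) * norm (y' r)" by (rule Cauchy_Schwarz_ineq2)
    also have "\<dots> \<le> norm (y r) * (l r * norm (y r))" 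
    proof (intro mult_left_mono bound)
      show "r \<in> I" using ab(2) r by auto
    qed simp
    also have "\<dots> \<le> norm (y r) * (L * norm (y r))" using L [of r] r by (intro mult_left_mono mult_right_mono) auto
    finally show ?thesis by (simp add: \<phi>_def dot_square_norm power2_eq_square abs_mult mult.left_commute)
  qed
  have "continuous_on I y" using y has_vector_derivative_continuous continuous_on_eq_continuous_within by blast
  then have cont: "continuous_on {a..b} \<phi>"
    unfolding \<phi>_def using ab(2) by (intro continuous_intros continuous_on_subset [OF _ ab(2)])
  have D: "((\<lambda>r. exp (c * r) * \<phi> r) has_real_derivative
      exp (c * r) * (c * \<phi> r + 2 * inner (y r) (y' r))) (at r)" if "a < r" "r < b" for r c
    using \<phi> [OF that] by (auto intro!: derivative_eq_intros simp: algebra_simps)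
  have "exp (- 2 * L * b) * \<phi> b \<le> exp (- 2 * L * a) * \<phi> a"
  proof (rule DERIV_nonpos_imp_decreasing_open [OF ab(1)])
    show "continuous_on {a..b} (\<lambda>r. exp (- 2 * L * r) * \<phi> r)" by (intro continuous_intros cont)
    fix r assume r: "a < r" "r < b"
    have "(- 2 * L) * \<phi> r + 2 * inner (y r) (y' r) \<le> 0" using abs [OF r] by linarith
    then have "exp (- 2 * L * r) * ((- 2 * L) * \<phi> r + 2 * inner (y r) (y' r)) \<le> 0"
      by (intro mult_nonneg_nonpos) auto
    then show "\<exists>d. ((\<lambda>r. exp (- 2 * L * r) * \<phi> r) has_real_derivative d) (at r) \<and> d \<le> 0"
      using D [OF r, of "- 2 * L"] by blast
  qed
  moreover have "exp (2 * L * a) * \<phi> a \<le> exp (2 * L * b) * \<phi> b"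
  proof (rule DERIV_nonneg_imp_increasing_open [OF ab(1)])
    show "continuous_on {a..b} (\<lambda>r. exp (2 * L * r) * \<phi> r)" by (intro continuous_intros cont)
    fix r assume r: "a < r" "r < b"
    have "0 \<le> (2 * L) * \<phi> r + 2 * inner (y r) (y' r)" using abs [OF r] by linarith
    then have "0 \<le> exp (2 * L * r) * ((2 * L) * \<phi> r + 2 * inner (y r) (y' r))"
      by (intro mult_nonneg_nonneg) auto
    then show "\<exists>d. ((\<lambda>r. exp (2 * L * r) * \<phi> r) has_real_derivative d) (at r) \<and> 0 \<le> d"
      using D [OF r, of "2 * L"] by blast
  qed
  moreover have "\<phi> a = 0 \<or> \<phi> b = 0" using I(3) by (auto simp: a_def b_def \<phi>_def min_def max_def)
  moreover have "0 \<le> \<phi> a" "0 \<le> \<phi> b" by (simp_all add: \<phi>_def)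
  ultimately have "\<phi> a = 0 \<and> \<phi> b = 0" by (auto simp: mult_le_0_iff)
  then have "\<phi> t = 0" by (auto simp: a_def b_def min_def max_def split: if_splits)
  then show ?thesis by (simp add: \<phi>_def)
qed

text \<open>Induction by the Horner scheme. The factor depends continuously on both arguments, so
  along two solutions it becomes a continuous function of time, as \<open>ode_eq_0\<close>
  demands.\<close>

lemma poly_locally_Lipschitz:
  fixes f :: "real poly"
  obtains l where "continuous_on UNIV l" "\<And>x y. \<bar>poly f x - poly f y\<bar> \<le> l (x, y) * \<bar>x - y\<bar>"
proof -
  have "\<exists>l. continuous_on UNIV l \<and> (\<forall>x y. \<bar>poly f x - poly f y\<bar> \<le> l (x, y) * \<bar>x - y\<bar>)"
  proof (induction f)
    case 0
    show ?case by (intro exI [of _ "\<lambda>_. 0"]) simp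
  next
    case (pCons c p)
    then obtain l where l: "continuous_on UNIV l" "\<And>x y. \<bar>poly p x - poly p y\<bar> \<le> l (x, y) * \<bar>x - y\<bar>" by blast
    have "\<bar>poly (pCons c p) x - poly (pCons c p) y\<bar> \<le> (\<bar>x\<bar> * l (x, y) + \<bar>poly p y\<bar>) * \<bar>x - y\<bar>" for x y
    proof -
      have "poly (pCons c p) x - poly (pCons c p) y = x * (poly p x - poly p y) + poly p y * (x - y)"
        by (simp add: algebra_simps)
      also have "\<bar>\<dots>\<bar> \<le> \<bar>x\<bar> * \<bar>poly p x - poly p y\<bar> + \<bar>poly p y\<bar> * \<bar>x - y\<bar>"
        by (metis abs_mult abs_triangle_ineq)
      also have "\<dots> \<le> \<bar>x\<bar> * (l (x, y) * \<bar>x - y\<bar>) + \<bar>poly p y\<bar> * \<bar>x - y\<bar>"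
        by (intro add_mono mult_left_mono l(2)) auto
      finally show ?thesis by (simp add: algebra_simps)
    qed
    moreover have "continuous_on UNIV (\<lambda>z. \<bar>fst z\<bar> * l z + \<bar>poly p (snd z)\<bar>)"
      by (intro continuous_intros l(1))
    ultimately show ?case by (intro exI [of _ "\<lambda>z. \<bar>fst z\<bar> * l z + \<bar>poly p (snd z)\<bar>"]) simp
  qed
  with that show ?thesis by blast
qed

lemma scalar_ode_unique:
  fixes u v :: "real \<Rightarrow> real" and f :: "real poly"
  assumes I: "is_interval I" "t0 \<in> I" "u t0 = v t0"
    and u: "\<And>t. t \<in> I \<Longrightarrow> (u has_real_derivative poly f (u t)) (at t within I)"
    and v: "\<And>t. t \<in> I \<Longrightarrow> (v has_real_derivative poly f (v t)) (at t within I)"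
    and t: "t \<in> I"
  shows "u t = v t"
proof -
  obtain l where l: "continuous_on UNIV l" "\<And>x y. \<bar>poly f x - poly f y\<bar> \<le> l (x, y) * \<bar>x - y\<bar>"
    using poly_locally_Lipschitz [of f] by blast
  have "continuous_on I u" "continuous_on I v"
    using u v DERIV_continuous continuous_on_eq_continuous_within by blast+
  then have c: "continuous_on I (\<lambda>t. l (u t, v t))"
    by (intro continuous_on_compose2 [OF l(1)] continuous_intros) auto
  have D: "((\<lambda>t. u t - v t) has_vector_derivative (poly f (u t) - poly f (v t))) (at t within I)" if "t \<in> I" for t
    using DERIV_diff [OF u v] that by (simp add: has_real_derivative_iff_has_vector_derivative)
  have "u t - v t = 0"
    by (rule ode_eq_0 [where y = "\<lambda>t. u t - v t", OF I(1,2) _ D c _ t]) (use I(3) l(2) in auto)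
  then show ?thesis by simp
qed

text \<open>If \<open>f\<close> vanished at some \<open>u s\<close>, the constant solution with that
  value would agree with \<open>u\<close> everywhere. So \<open>poly f (u s)\<close> has no zero on
  \<open>I\<close>, and by connectedness it keeps its sign.\<close>

lemma scalar_ode_monotone:
  fixes u :: "real \<Rightarrow> real" and f :: "real poly"
  assumes I: "is_interval I"
    and u: "\<And>t. t \<in> I \<Longrightarrow> (u has_real_derivative poly f (u t)) (at t within I)"
    and nc: "\<not> u constant_on I"
  shows "monotone_on I (<) (<) u \<or> monotone_on I (<) (>) u"
proof -
  have nz: "poly f (u s) \<noteq> 0" if "s \<in> I" for s
  proof
    assume "poly f (u s) = 0"
    then have "u t = u s" if "t \<in> I" for t
      using scalar_ode_unique [OF I \<open>s \<in> I\<close> _ u _ that, of "\<lambda>_. u s"] by simp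
    then show False using nc by (auto simp: constant_on_def)
  qed
  have cu: "continuous_on I u" using u DERIV_continuous continuous_on_eq_continuous_within by blast
  have sgn: "(\<forall>s\<in>I. poly f (u s) > 0) \<or> (\<forall>s\<in>I. poly f (u s) < 0)"
  proof (rule ccontr)
    assume "\<not> ?thesis"
    then obtain r s where rs: "r \<in> I" "s \<in> I" "poly f (u r) \<le> 0" "0 \<le> poly f (u s)" by (meson not_less)
    have "connected ((\<lambda>s. poly f (u s)) ` I)"
      using I cu by (intro connected_continuous_image continuous_intros) (auto simp: is_interval_connected_1)
    then have "0 \<in> (\<lambda>s. poly f (u s)) ` I"
      by (rule connectedD_interval [of _ "poly f (u r)" "poly f (u s)"]) (use rs in auto)
    with nz show False by auto
  qed
  have mvt: "\<exists>x\<in>I. u s - u r = (s - r) * poly f (u x)" if rs: "r \<in> I" "s \<in> I" "r < s" for r s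
  proof -
    have sub: "{r..s} \<subseteq> I" by (rule interval_subset [OF I rs(1,2)])
    obtain x where "x \<in> {r<..<s}" "u s - u r = (\<lambda>h. h * poly f (u x)) (s - r)"
    proof (rule mvt [OF rs(3) continuous_on_subset [OF cu sub]])
      fix x assume x: "r < x" "x < s"
      have "x \<in> I" "{r<..<s} \<subseteq> I" using sub x by auto
      then have "(u has_vector_derivative poly f (u x)) (at x)"
        using has_vector_derivative_at_interior [of u _ x I r s] u [of x] x
        by (simp add: has_real_derivative_iff_has_vector_derivative)
      then show "(u has_derivative (\<lambda>h. h * poly f (u x))) (at x)"
        by (simp add: has_vector_derivative_def)
    qed auto
    moreover from this have "x \<in> I" using sub by auto
    ultimately show ?thesis by blast
  qed
  from sgn show ?thesis
  proof
    assume pos: "\<forall>s\<in>I. poly f (u s) > 0"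
    have "u r < u s" if "r \<in> I" "s \<in> I" "r < s" for r s
    proof -
      obtain x where "x \<in> I" "u s - u r = (s - r) * poly f (u x)" using mvt \<open>r \<in> I\<close> \<open>s \<in> I\<close> \<open>r < s\<close> by blast
      moreover have "(s - r) * poly f (u x) > 0" using pos \<open>x \<in> I\<close> \<open>r < s\<close> by simp
      ultimately show ?thesis by simp
    qed
    then show ?thesis by (simp add: monotone_on_def)
  next
    assume neg: "\<forall>s\<in>I. poly f (u s) < 0"
    have "u r > u s" if "r \<in> I" "s \<in> I" "r < s" for r s
    proof -
      obtain x where "x \<in> I" "u s - u r = (s - r) * poly f (u x)" using mvt \<open>r \<in> I\<close> \<open>s \<in> I\<close> \<open>r < s\<close> by blast
      moreover have "(s - r) * poly f (u x) < 0" using neg \<open>x \<in> I\<close> \<open>r < s\<close> by (simp add: mult_pos_neg)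
      ultimately show ?thesis by simp
    qed
    then show ?thesis by (simp add: monotone_on_def)
  qed
qed

section \<open>Polynomial dynamics\<close>

lemma bounded_bilinear_matrix_vector_mult:
  "bounded_bilinear ((*v) :: real^'m^'n \<Rightarrow> real^'m \<Rightarrow> real^'n)"
  by (rule bounded_bilinear_of_bilinear)
    (simp_all add: matrix_vector_mult_add_rdistrib matrix_vector_right_distrib
      scaleR_matrix_vector_assoc matrix_vector_mult_scaleR)

lemma matrix_pow_commute:
  assumes "A ** B = B ** A" shows "matrix_pow A k ** B = B ** matrix_pow A k"
proof (induction k)
  case (Suc k)
  have "matrix_pow A (Suc k) ** B = A ** (matrix_pow A k ** B)" by (simp add: matrix_mul_assoc)
  also have "\<dots> = (A ** B) ** matrix_pow A k" by (simp add: Suc matrix_mul_assoc)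
  finally show ?case by (simp add: assms matrix_mul_assoc)
qed simp

lemma poly_generator_commute:
  assumes "A ** B = B ** A" shows "poly_generator K \<alpha> A ** B = B ** poly_generator K \<alpha> A"
  unfolding poly_generator_def
  by (simp add: matrix_sum_left matrix_sum_right matrix_scaleR_simps matrix_pow_commute [OF assms])

lemma symmetric_matrix_pow:
  assumes "symmetric_matrix A" shows "symmetric_matrix (matrix_pow A k)"
  using assms matrix_pow_commute [of A A]
  by (induction k) (simp_all add: symmetric_matrix_def matrix_transpose_mul)

lemma symmetric_poly_generator:
  assumes "symmetric_matrix A" shows "symmetric_matrix (poly_generator K \<alpha> A)"
proof -
  have "transpose (\<Sum>k\<in>S. \<alpha> k *\<^sub>R matrix_pow A k) = (\<Sum>k\<in>S. \<alpha> k *\<^sub>R matrix_pow A k)" for S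
    using symmetric_matrix_pow [OF assms]
    by (simp add: linear_sum [OF bounded_linear.linear [OF bounded_linear_transpose]] transpose_scalar symmetric_matrix_def)
  then show ?thesis by (simp add: symmetric_matrix_def poly_generator_def)
qed

lemma symmetric_gram: "symmetric_matrix (gram X)"
  by (simp add: symmetric_matrix_def gram_def matrix_transpose_mul)

lemma matrix_pow_eigenvector:
  assumes "A *v v = c *\<^sub>R v" shows "matrix_pow A k *v v = c ^ k *\<^sub>R v"
  using assms
  by (induction k) (simp_all add: matrix_vector_mul_assoc [symmetric] matrix_vector_mult_scaleR mult.commute)

definition generator_poly :: "nat \<Rightarrow> (nat \<Rightarrow> real) \<Rightarrow> real poly" where
  "generator_poly K \<alpha> = (\<Sum>k\<le>K. monom (\<alpha> k) k)"

lemma poly_generator_eigenvector: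
  assumes "A *v v = c *\<^sub>R v"
  shows "poly_generator K \<alpha> A *v v = poly (generator_poly K \<alpha>) c *\<^sub>R v"
proof -
  have "(\<Sum>k\<in>S. \<alpha> k *\<^sub>R matrix_pow A k) *v v = (\<Sum>k\<in>S. \<alpha> k * c ^ k) *\<^sub>R v" if "finite S" for S
    using that
    by induction (simp_all add: matrix_vector_mult_add_rdistrib scaleR_matrix_vector_assoc [symmetric]
        matrix_pow_eigenvector [OF assms] scaleR_left_distrib)
  then show ?thesis by (simp add: poly_generator_def generator_poly_def poly_sum poly_monom)
qed

lemma continuous_on_matrix_pow: "continuous_on S (\<lambda>A. matrix_pow A k)"
  by (induction k) (auto intro!: bounded_bilinear.continuous_on [OF bounded_bilinear_matrix_mult] continuous_on_const continuous_on_id)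

lemma continuous_on_poly_generator: "continuous_on S (poly_generator K \<alpha>)"
  unfolding poly_generator_def by (intro continuous_intros continuous_on_matrix_pow)

text \<open>Induction with \<open>[A^(k+1), B] = A [A^k, B] + [A, B] A^k\<close>. The factor depends
  on \<open>A\<close> alone and continuously, so it stays continuous along the flow.\<close>

lemma commutator_matrix_pow_bound:
  "\<exists>c. continuous_on UNIV c \<and> (\<forall>A B :: real^'n^'n.
     norm (matrix_pow A k ** B - B ** matrix_pow A k) \<le> c A * norm (A ** B - B ** A))"
proof (induction k)
  case 0
  show ?case by (intro exI [of _ "\<lambda>_. 0"]) simp
next
  case (Suc k)
  then obtain c where c: "continuous_on UNIV c"
    "\<And>A B :: real^'n^'n. norm (matrix_pow A k ** B - B ** matrix_pow A k) \<le> c A * norm (A ** B - B ** A)" by blast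
  obtain C where C: "C > 0" "\<And>(A :: real^'n^'n) (B :: real^'n^'n). norm (A ** B) \<le> norm A * norm B * C"
    using bounded_bilinear.pos_bounded [OF bounded_bilinear_matrix_mult] by blast
  have "norm (matrix_pow A (Suc k) ** B - B ** matrix_pow A (Suc k))
     \<le> (norm A * c A * C + norm (matrix_pow A k) * C) * norm (A ** B - B ** A)" for A B :: "real^'n^'n"
  proof -
    let ?M = "matrix_pow A k ** B - B ** matrix_pow A k" and ?q = "A ** B - B ** A"
    have "matrix_pow A (Suc k) ** B - B ** matrix_pow A (Suc k) = A ** ?M + ?q ** matrix_pow A k"
      by (simp add: matrix_algebra)
    also have "norm \<dots> \<le> norm A * norm ?M * C + norm ?q * norm (matrix_pow A k) * C"
      by (rule norm_triangle_le [OF add_mono [OF C(2) C(2)]])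
    also have "\<dots> \<le> norm A * (c A * norm ?q) * C + norm ?q * norm (matrix_pow A k) * C"
      using C(1) by (intro add_mono mult_right_mono mult_left_mono c) auto
    finally show ?thesis by (simp add: algebra_simps)
  qed
  moreover have "continuous_on UNIV (\<lambda>A. norm A * c A * C + norm (matrix_pow A k) * C)"
    by (intro continuous_intros c continuous_on_matrix_pow)
  ultimately show ?case by blast
qed

lemma commutator_poly_generator_bound:
  obtains c where "continuous_on UNIV c"
    "\<And>A B :: real^'n^'n. norm (poly_generator K \<alpha> A ** B - B ** poly_generator K \<alpha> A) \<le> c A * norm (A ** B - B ** A)"
proof -
  obtain c where c: "\<And>k. continuous_on UNIV (c k)" "\<And>k (A :: real^'n^'n) B.
      norm (matrix_pow A k ** B - B ** matrix_pow A k) \<le> c k A * norm (A ** B - B ** A)"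
    using commutator_matrix_pow_bound by metis
  show ?thesis
  proof
    show "continuous_on UNIV (\<lambda>A. \<Sum>k\<le>K. \<bar>\<alpha> k\<bar> * c k A)" by (intro continuous_intros c)
    fix A B :: "real^'n^'n"
    have "poly_generator K \<alpha> A ** B - B ** poly_generator K \<alpha> A
       = (\<Sum>k\<le>K. \<alpha> k *\<^sub>R (matrix_pow A k ** B - B ** matrix_pow A k))"
      by (simp add: poly_generator_def matrix_sum_left matrix_sum_right matrix_scaleR_simps sum_subtractf scaleR_diff_right)
    also have "norm \<dots> \<le> (\<Sum>k\<le>K. \<bar>\<alpha> k\<bar> * (c k A * norm (A ** B - B ** A)))"
      by (intro sum_norm_le) (auto intro!: mult_left_mono c)
    also have "\<dots> = (\<Sum>k\<le>K. \<bar>\<alpha> k\<bar> * c k A) * norm (A ** B - B ** A)"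
      by (simp add: sum_distrib_right mult.assoc)
    finally show "norm (poly_generator K \<alpha> A ** B - B ** poly_generator K \<alpha> A)
      \<le> (\<Sum>k\<le>K. \<bar>\<alpha> k\<bar> * c k A) * norm (A ** B - B ** A)" .
  qed
qed

section \<open>Commutation and kernel along a trajectory\<close>

context
  fixes X :: "real \<Rightarrow> real^'d^'n" and K :: nat and \<alpha> :: "nat \<Rightarrow> real" and I :: "real set"
  assumes I: "is_interval I"
    and X: "\<And>t. t \<in> I \<Longrightarrow>
      (X has_vector_derivative poly_generator K \<alpha> (gram (X t)) ** X t) (at t within I)"
begin

private abbreviation (input) "P t \<equiv> gram (X t)"
private abbreviation (input) "N t \<equiv> poly_generator K \<alpha> (gram (X t))"

lemma flow_has_derivative:
  assumes "t \<in> I"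
  shows "((\<lambda>t. P t) has_vector_derivative N t ** P t + P t ** N t) (at t within I)"
proof -
  have "((\<lambda>t. gram (X t)) has_derivative (\<lambda>h. dgram (X t) (h *\<^sub>R (N t ** X t)))) (at t within I)"
    using X [OF assms] unfolding has_vector_derivative_def
    by (rule has_derivative_compose) (rule gram_has_derivative)
  moreover have "dgram (X t) (N t ** X t) = N t ** P t + P t ** N t"
    using symmetric_poly_generator [OF symmetric_gram, of K \<alpha> "X t"]
    by (simp add: dgram_def gram_def matrix_algebra symmetric_matrix_def)
  ultimately show ?thesis
    by (simp add: has_vector_derivative_def linear_cmul [OF linear_dgram])
qed

lemma generator_gram_commute: "N t ** P t = P t ** N t"
  by (rule poly_generator_commute) simp

lemma flow_continuous: "continuous_on I (\<lambda>t. P t)" "continuous_on I (\<lambda>t. N t)"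
proof -
  show 1: "continuous_on I (\<lambda>t. P t)"
    using flow_has_derivative has_vector_derivative_continuous continuous_on_eq_continuous_within by blast
  show "continuous_on I (\<lambda>t. N t)"
    by (rule continuous_on_compose2 [OF continuous_on_poly_generator 1]) auto
qed

text \<open>The derivative of the commutator \<open>y\<close> of \<open>P t\<close> with
  \<open>B = P t0\<close> is \<open>N y + [N, B] P + P [N, B] + y N\<close>. As \<open>N\<close> is
  a polynomial in \<open>P\<close>, the norm of \<open>[N, B]\<close> is controlled by that of
  \<open>y\<close>, and \<open>ode_eq_0\<close> applies.\<close>

lemma flow_commute:
  assumes t0: "t0 \<in> I" and t: "t \<in> I"
  shows "P t ** P t0 = P t0 ** P t"
proof -
  let ?B = "P t0"
  let ?y = "\<lambda>t. P t ** ?B - ?B ** P t"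
  obtain c where c: "continuous_on UNIV c" "\<And>A B :: real^'n^'n.
      norm (poly_generator K \<alpha> A ** B - B ** poly_generator K \<alpha> A) \<le> c A * norm (A ** B - B ** A)"
    using commutator_poly_generator_bound [of K \<alpha>, where 'n = 'n] by blast
  obtain C where C: "C > 0" "\<And>(A :: real^'n^'n) (B :: real^'n^'n). norm (A ** B) \<le> norm A * norm B * C"
    using bounded_bilinear.pos_bounded [OF bounded_bilinear_matrix_mult] by blast
  have arith1: "(a * y * C + q * p * C) + (p * q * C + y * a * C) = 2 * (a * y * C + p * q * C)"
    and arith2: "2 * (a * y * C + p * (c' * y) * C) = (2 * C * (a + p * c')) * y" for a y p q c' :: real
    by (simp_all add: algebra_simps)
  have "?y t = 0"
  proof (rule ode_eq_0 [where y = ?y, OF I t0 _ _ _ _ t])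
    fix t assume t: "t \<in> I"
    have L: "bounded_linear (\<lambda>A. A ** ?B - ?B ** A)"
      by (intro bounded_linear_sub bounded_bilinear.bounded_linear_left [OF bounded_bilinear_matrix_mult]
          bounded_bilinear.bounded_linear_right [OF bounded_bilinear_matrix_mult])
    show "(?y has_vector_derivative
        (N t ** P t + P t ** N t) ** ?B - ?B ** (N t ** P t + P t ** N t)) (at t within I)"
      using bounded_linear.has_vector_derivative [OF L flow_has_derivative [OF t]] .
    let ?n = "N t ** ?B - ?B ** N t"
    have n: "norm ?n \<le> c (P t) * norm (?y t)" by (rule c)
    have eq: "(N t ** P t + P t ** N t) ** ?B - ?B ** (N t ** P t + P t ** N t)
      = (N t ** ?y t + ?n ** P t) + (P t ** ?n + ?y t ** N t)"
      by (simp add: matrix_algebra)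
    have "norm ((N t ** P t + P t ** N t) ** ?B - ?B ** (N t ** P t + P t ** N t))
        \<le> (norm (N t) * norm (?y t) * C + norm ?n * norm (P t) * C)
        + (norm (P t) * norm ?n * C + norm (?y t) * norm (N t) * C)"
      unfolding eq
      by (rule norm_triangle_le [OF add_mono [OF norm_triangle_le [OF add_mono [OF C(2) C(2)]]
            norm_triangle_le [OF add_mono [OF C(2) C(2)]]]])
    also have "\<dots> = 2 * (norm (N t) * norm (?y t) * C + norm (P t) * norm ?n * C)"
      by (rule arith1)
    also have "\<dots> \<le> 2 * (norm (N t) * norm (?y t) * C + norm (P t) * (c (P t) * norm (?y t)) * C)"
      using C(1) n by (intro mult_left_mono add_left_mono mult_right_mono) simp_all
    also have "\<dots> = (2 * C * (norm (N t) + norm (P t) * c (P t))) * norm (?y t)"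
      by (rule arith2)
    finally show "norm ((N t ** P t + P t ** N t) ** ?B - ?B ** (N t ** P t + P t ** N t))
       \<le> (2 * C * (norm (N t) + norm (P t) * c (P t))) * norm (?y t)" .
  next
    show "continuous_on I (\<lambda>t. 2 * C * (norm (N t) + norm (P t) * c (P t)))"
      by (intro continuous_intros flow_continuous continuous_on_compose2 [OF c(1) flow_continuous(1)]) auto
  qed simp
  then show ?thesis by simp
qed

text \<open>Since \<open>N\<close> and \<open>P\<close> commute, \<open>P u\<close> obeys the linear
  equation \<open>(P u)' = 2 N (P u)\<close>. This covers the eigenvalue 0, which may be multiple,
  so that commutation alone does not fix its eigenvectors.\<close>

lemma flow_kernel:
  assumes t0: "t0 \<in> I" and u: "P t0 *v u = 0" and t: "t \<in> I"
  shows "P t *v u = 0"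
proof -
  obtain C where C: "C > 0" "\<And>(A :: real^'n^'n) v. norm (A *v v) \<le> norm A * norm v * C"
    using bounded_bilinear.pos_bounded [OF bounded_bilinear_matrix_vector_mult] by blast
  show ?thesis
  proof (rule ode_eq_0 [where y = "\<lambda>t. P t *v u", OF I t0 u _ _ _ t])
    fix t assume t: "t \<in> I"
    show "((\<lambda>t. P t *v u) has_vector_derivative (N t ** P t + P t ** N t) *v u) (at t within I)"
      using bounded_linear.has_vector_derivative [OF
          bounded_bilinear.bounded_linear_left [OF bounded_bilinear_matrix_vector_mult] flow_has_derivative [OF t]] .
    have "(N t ** P t + P t ** N t) *v u = 2 *\<^sub>R (N t *v (P t *v u))"
      by (simp only: generator_gram_commute [symmetric] matrix_vector_mult_add_rdistrib matrix_vector_mul_assoc scaleR_2)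
    also have "norm \<dots> \<le> 2 * (norm (N t) * norm (P t *v u) * C)" using C(2) [of "N t" "P t *v u"] by simp
    finally show "norm ((N t ** P t + P t ** N t) *v u) \<le> (2 * C * norm (N t)) * norm (P t *v u)"
      by (simp add: mult_ac)
  next
    show "continuous_on I (\<lambda>t. 2 * C * norm (N t))" by (intro continuous_intros flow_continuous)
  qed
qed

section \<open>Evolution of the individual eigenvalues\<close>

context
  fixes b :: "'n \<Rightarrow> real^'n" and m :: "'n \<Rightarrow> real" and t0 :: real
  assumes b: "orthonormal_family b" and t0: "t0 \<in> I" and m: "\<And>i. P t0 *v b i = m i *\<^sub>R b i"
    and simple: "inj_on m {i. m i \<noteq> 0}"
begin

text \<open>A Rayleigh quotient: it is linear in \<open>P t\<close>, so it inherits the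
  differentiability of \<open>P\<close>.\<close>

definition flow_eigenvalue :: "'n \<Rightarrow> real \<Rightarrow> real" where
  "flow_eigenvalue i t = inner (b i) (P t *v b i)"

text \<open>For \<open>m i \<noteq> 0\<close>, commutation keeps \<open>P t *v b i\<close> in the
  \<open>m i\<close>-eigenspace of \<open>P t0\<close>, which by simplicity is the line of
  \<open>b i\<close>. The case \<open>m i = 0\<close> is \<open>flow_kernel\<close>.\<close>

lemma flow_eigenvector:
  assumes t: "t \<in> I" shows "P t *v b i = flow_eigenvalue i t *\<^sub>R b i"
proof (cases "m i = 0")
  case True
  then have "P t *v b i = 0" using flow_kernel [OF t0 _ t] m by simp
  then show ?thesis by (simp add: flow_eigenvalue_def)
next
  case False
  let ?z = "P t *v b i"
  have "inner ?z (b j) = 0" if "j \<noteq> i" for j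
  proof -
    have "m j * inner ?z (b j) = inner ?z (P t0 *v b j)" by (simp add: m)
    also have "\<dots> = inner ((P t0 ** P t) *v b i) (b j)"
      by (simp add: symmetric_matrix_inner [OF symmetric_gram] matrix_vector_mul_assoc [symmetric])
    also have "\<dots> = inner (P t *v (P t0 *v b i)) (b j)"
      by (simp add: flow_commute [OF t0 t, symmetric] matrix_vector_mul_assoc)
    also have "\<dots> = m i * inner ?z (b j)" by (simp add: m matrix_vector_mult_scaleR)
    finally have "m j = m i \<or> inner ?z (b j) = 0" by auto
    moreover have "m j \<noteq> m i" using simple False that by (auto simp: inj_on_def)
    ultimately show ?thesis by blast
  qed
  then have "(\<Sum>j\<in>UNIV. inner ?z (b j) *\<^sub>R b j) = (\<Sum>j\<in>{i}. inner ?z (b j) *\<^sub>R b j)"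
    by (intro sum.mono_neutral_right) auto
  then show ?thesis using orthonormal_expand [OF b, of ?z]
    by (simp add: flow_eigenvalue_def inner_commute)
qed

lemma flow_eigenvalue_initial: "flow_eigenvalue i t0 = m i"
  using b by (simp add: flow_eigenvalue_def m orthonormal_family_def)

text \<open>The polynomial is \<open>2 x p(x)\<close>; the 2 counts the equal terms
  \<open>N P\<close> and \<open>P N\<close>.\<close>

lemma flow_eigenvalue_has_derivative:
  assumes t: "t \<in> I"
  shows "(flow_eigenvalue i has_real_derivative
      poly (smult 2 (pCons 0 (generator_poly K \<alpha>))) (flow_eigenvalue i t)) (at t within I)"
proof -
  let ?l = "flow_eigenvalue i t" and ?p = "poly (generator_poly K \<alpha>) (flow_eigenvalue i t)"
  have L: "bounded_linear (\<lambda>A. inner (b i) (A *v b i))"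
    by (rule bounded_linear_compose [OF bounded_linear_inner_right
          bounded_bilinear.bounded_linear_left [OF bounded_bilinear_matrix_vector_mult]])
  have "(flow_eigenvalue i has_vector_derivative
      inner (b i) ((N t ** P t + P t ** N t) *v b i)) (at t within I)"
    unfolding flow_eigenvalue_def [abs_def]
    using bounded_linear.has_vector_derivative [OF L flow_has_derivative [OF t]] .
  moreover have "(N t ** P t + P t ** N t) *v b i = (2 * (?l * ?p)) *\<^sub>R b i"
  proof -
    have "(N t ** P t + P t ** N t) *v b i = N t *v (P t *v b i) + N t *v (P t *v b i)"
      by (simp only: generator_gram_commute [symmetric] matrix_vector_mult_add_rdistrib matrix_vector_mul_assoc)
    moreover have "N t *v (P t *v b i) = (?l * ?p) *\<^sub>R b i"
      by (simp only: flow_eigenvector [OF t] matrix_vector_mult_scaleR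
          poly_generator_eigenvector [OF flow_eigenvector [OF t]] scaleR_scaleR)
    ultimately show ?thesis by (simp add: scaleR_left_distrib [symmetric])
  qed
  ultimately show ?thesis
    using b by (simp add: has_real_derivative_iff_has_vector_derivative orthonormal_family_def mult.left_commute)
qed

lemma flow_eigenvalue_eq_iff:
  assumes "t \<in> I" shows "flow_eigenvalue i t = flow_eigenvalue j t \<longleftrightarrow> m i = m j"
  using scalar_ode_unique [OF I assms _ flow_eigenvalue_has_derivative flow_eigenvalue_has_derivative t0]
    scalar_ode_unique [OF I t0 _ flow_eigenvalue_has_derivative flow_eigenvalue_has_derivative assms]
  by (metis flow_eigenvalue_initial)

text \<open>The factor \<open>x\<close> makes 0 an equilibrium, and uniqueness is applied in both
  time directions.\<close>

lemma flow_eigenvalue_eq_0_iff: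
  assumes "t \<in> I" shows "flow_eigenvalue i t = 0 \<longleftrightarrow> m i = 0"
proof -
  let ?f = "smult 2 (pCons 0 (generator_poly K \<alpha>))"
  have "((\<lambda>t. 0) has_real_derivative poly ?f 0) (at s within I)" for s by simp
  from scalar_ode_unique [OF I assms _ flow_eigenvalue_has_derivative this t0]
    scalar_ode_unique [OF I t0 _ flow_eigenvalue_has_derivative this assms]
  show ?thesis by (metis flow_eigenvalue_initial)
qed

text \<open>A change of order would force a crossing by the intermediate value theorem, and
  \<open>flow_eigenvalue_eq_iff\<close> carries equality back to \<open>t0\<close>.\<close>

lemma flow_eigenvalue_less:
  assumes t: "t \<in> I" and less: "m i < m j"
  shows "flow_eigenvalue i t < flow_eigenvalue j t"
proof (rule ccontr)
  assume neg: "\<not> ?thesis"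
  let ?g = "\<lambda>s. flow_eigenvalue j s - flow_eigenvalue i s"
  have "continuous_on I (flow_eigenvalue k)" for k
    using flow_eigenvalue_has_derivative DERIV_continuous continuous_on_eq_continuous_within by blast
  then have "connected (?g ` I)"
    using I by (intro connected_continuous_image continuous_intros) (auto simp: is_interval_connected_1)
  moreover have "?g t \<in> ?g ` I" "?g t0 \<in> ?g ` I" using t t0 by blast+
  moreover have "?g t \<le> 0" "0 \<le> ?g t0" using neg less by (simp_all add: flow_eigenvalue_initial)
  ultimately have "0 \<in> ?g ` I" by (rule connectedD_interval)
  then obtain s where "s \<in> I" "flow_eigenvalue i s = flow_eigenvalue j s" by auto
  then show False using flow_eigenvalue_eq_iff less by auto
qed

lemma flow_gram_eqI:
  assumes "s \<in> I" "t \<in> I" "\<And>i. flow_eigenvalue i s = flow_eigenvalue i t"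
  shows "P s = P t"
  by (rule orthonormal_matrix_eqI [OF b]) (simp add: flow_eigenvector assms)

text \<open>A return of \<open>P\<close> repeats every eigenvalue at two distinct times, which
  strict monotonicity forbids; so all eigenvalues are constant, and they determine \<open>P\<close>
  in the fixed basis \<open>b\<close>.\<close>

lemma flow_no_loop:
  assumes "s \<in> I" "t \<in> I" "s \<noteq> t" "P s = P t"
  shows "(\<lambda>t. P t) constant_on I"
proof -
  have const: "flow_eigenvalue i constant_on I" for i
  proof (rule ccontr)
    assume nc: "\<not> flow_eigenvalue i constant_on I"
    have "monotone_on I (<) (<) (flow_eigenvalue i) \<or> monotone_on I (<) (>) (flow_eigenvalue i)"
      by (rule scalar_ode_monotone [OF I _ nc]) (rule flow_eigenvalue_has_derivative)
    then have "flow_eigenvalue i s \<noteq> flow_eigenvalue i t"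
      using assms(1-3) by (auto simp: monotone_on_def neq_iff)
    then show False using assms(4) by (simp add: flow_eigenvalue_def)
  qed
  have "P r = P s" if "r \<in> I" for r
  proof (rule flow_gram_eqI [OF that assms(1)])
    show "flow_eigenvalue i r = flow_eigenvalue i s" for i
      using const [of i] that assms(1) unfolding constant_on_def by metis
  qed
  then show ?thesis by (auto simp: constant_on_def)
qed

text \<open>The list \<open>ks\<close>, fixed at \<open>t0\<close>, sorts the nonzero eigenvalues at
  every time because the flow preserves order and vanishing. So each ranked eigenvalue follows a
  single index.\<close>

lemma flow_nonzero_eigenvalue:
  assumes ks: "set ks = {i. m i \<noteq> 0}" "distinct ks" "sorted (map m ks)"
    and \<iota>: "1 \<le> \<iota>" "\<iota> \<le> length ks" and t: "t \<in> I"
  shows "nonzero_eigenvalue (P t) \<iota> = flow_eigenvalue (rev ks ! (\<iota> - 1)) t"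
proof (rule nonzero_eigenvalue_eigenbasis [OF b flow_eigenvector [OF t] _ ks(2) _ \<iota>])
  show "set ks = {i. flow_eigenvalue i t \<noteq> 0}" by (simp add: ks(1) flow_eigenvalue_eq_0_iff [OF t])
  have "flow_eigenvalue i t \<le> flow_eigenvalue j t" if "m i \<le> m j" for i j
    using that flow_eigenvalue_less [OF t, of i j] flow_eigenvalue_eq_iff [OF t, of i j] by force
  then show "sorted (map (\<lambda>i. flow_eigenvalue i t) ks)"
    using ks(3) by (auto simp: sorted_iff_nth_mono)
qed

end

end

theorem proposition10:
  fixes X :: "real \<Rightarrow> real^'d^'n"
    and K :: nat and \<alpha> :: "nat \<Rightarrow> real" and I :: "real set"
    and P :: "real \<Rightarrow> real^'n^'n" and N :: "real^'n^'n \<Rightarrow> real^'n^'n"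
    and lam :: "nat \<Rightarrow> real \<Rightarrow> real"
  assumes "2 \<le> CARD('d)" and "CARD('d) \<le> CARD('n)"
    and "is_interval I" and "0 \<in> I"
    and P: "\<And>t. P t = gram (X t)"
    and N: "\<And>A. N A = poly_generator K \<alpha> A"
    and lam: "\<And>\<iota> t. lam \<iota> t = nonzero_eigenvalue (P t) \<iota>"
    and "\<And>t. t \<in> I \<Longrightarrow> X t \<in> gram_domain"
    and "\<And>t. t \<in> I \<Longrightarrow> (X has_vector_derivative N (P t) ** X t) (at t within I)"
    and "\<And>\<iota>. 1 \<le> \<iota> \<Longrightarrow> \<iota> < CARD('d) \<Longrightarrow> lam (\<iota> + 1) 0 < lam \<iota> 0"
    and "0 < lam (CARD('d)) 0"
  shows "(\<forall>t1\<in>I. \<forall>t2\<in>I. N (P t1) ** N (P t2) = N (P t2) ** N (P t1))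
    \<and> (\<exists>b :: 'n \<Rightarrow> real^'n.
          (\<forall>i j. inner (b i) (b j) = (if i = j then 1 else 0)) \<and>
          (\<forall>t\<in>I. \<forall>i. \<exists>\<mu>. N (P t) *v b i = \<mu> *\<^sub>R b i))
    \<and> (\<forall>s\<in>I. \<forall>t1\<in>I. \<forall>t2\<in>I.
          let v = frechet_derivative gram (at (X s)) (N (P t1) ** X s);
              w = frechet_derivative gram (at (X s)) (N (P t2) ** X s)
          in v \<noteq> w \<and> independent {v, w} \<longrightarrow>
             riemannian_quotient.sectional_curvature (gram_domain :: (real^'d^'n) set) gram
               (gram (X s)) (span {v, w}) = 0)
    \<and> (\<forall>\<iota>\<in>{1..CARD('d)}.
          (\<exists>f :: real poly. \<forall>t\<in>I. (lam \<iota> has_real_derivative poly f (lam \<iota> t)) (at t within I))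
          \<and> (\<not> lam \<iota> constant_on I \<longrightarrow>
               monotone_on I (<) (<) (lam \<iota>) \<or> monotone_on I (<) (>) (lam \<iota>)))
    \<and> (\<forall>t0\<in>I. \<forall>t1\<in>I. t0 \<noteq> t1 \<and> P t0 = P t1 \<longrightarrow> P constant_on I)"
proof -
  note I = assms(3) and dom = assms(8)
  have flow: "(X has_vector_derivative poly_generator K \<alpha> (gram (X t)) ** X t) (at t within I)" if "t \<in> I" for t
    using assms(9) [OF that] by (simp add: N P)
  obtain b m where b: "orthonormal_family b" and m: "\<And>i. gram (X 0) *v b i = m i *\<^sub>R b i"
    using symmetric_orthonormal_eigenbasis [OF symmetric_gram [of "X 0"]] by metis
  obtain xs where xs: "set xs = {i. m i \<noteq> 0}" "distinct xs"
    using finite_distinct_list [of "{i. m i \<noteq> 0}"] by auto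
  define ks where "ks = sort_key m xs"
  have ks: "set ks = {i. m i \<noteq> 0}" "distinct ks" "sorted (map m ks)" by (simp_all add: ks_def xs)
  have "rank (X 0) = CARD('d)" using dom [OF assms(4)] by (simp add: gram_domain_def)
  from card_nonzero_eigenvalues_gram [OF b this m] have len: "length ks = CARD('d)"
    using distinct_card [OF ks(2)] by (simp add: ks(1))
  have lam0: "lam \<iota> 0 = m (ks ! (CARD('d) - \<iota>))" if "1 \<le> \<iota>" "\<iota> \<le> CARD('d)" for \<iota>
    using nonzero_eigenvalue_eigenbasis [OF b m ks that(1)] that by (simp add: lam P len rev_nth)
  have "sorted_wrt (<) (map m ks)"
    unfolding sorted_wrt_iff_nth_Suc_transp [OF transp_on_less]
  proof (intro allI impI)
    fix i assume i: "Suc i < length (map m ks)"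
    \<comment> \<open>Rank \<open>\<iota>\<close> sits at position \<open>CARD('d) - \<iota>\<close>
      of the ascending list, so positions \<open>i\<close> and \<open>Suc i\<close> carry the ranks
      \<open>\<iota> + 1\<close> and \<open>\<iota>\<close>.\<close>
    define \<iota> where "\<iota> = CARD('d) - Suc i"
    have \<iota>: "1 \<le> \<iota>" "\<iota> < CARD('d)" "CARD('d) - (\<iota> + 1) = i" "CARD('d) - \<iota> = Suc i"
      using i by (auto simp: \<iota>_def len)
    have "lam (\<iota> + 1) 0 < lam \<iota> 0" by (rule assms(10) [OF \<iota>(1,2)])
    then show "map m ks ! i < map m ks ! Suc i"
      using lam0 [of \<iota>] lam0 [of "\<iota> + 1"] \<iota> i by simp
  qed
  then have simple: "inj_on m {i. m i \<noteq> 0}"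
    using strict_sorted_iff [of "map m ks"] by (simp add: distinct_map ks(1))
  note eigen = I flow b assms(4) m simple
  have comm: "P s ** P t = P t ** P s" if "s \<in> I" "t \<in> I" for s t
    unfolding P using flow_commute [OF I flow that(2,1)] .
  have Ncomm: "N (P s) ** N (P t) = N (P t) ** N (P s)" if "s \<in> I" "t \<in> I" for s t
    unfolding N by (rule poly_generator_commute)
      (rule poly_generator_commute [symmetric], rule comm [symmetric], fact+)
  have Nsym: "symmetric_matrix (N (P t))" for t
    unfolding N P by (rule symmetric_poly_generator [OF symmetric_gram])
  have diag: "\<exists>b :: 'n \<Rightarrow> real^'n. (\<forall>i j. inner (b i) (b j) = (if i = j then 1 else 0)) \<and>
      (\<forall>t\<in>I. \<forall>i. \<exists>\<mu>. N (P t) *v b i = \<mu> *\<^sub>R b i)"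
  proof (intro exI [of _ b] conjI ballI allI)
    show "inner (b i) (b j) = (if i = j then 1 else 0)" for i j
      using b by (simp add: orthonormal_family_def)
    show "\<exists>\<mu>. N (P t) *v b i = \<mu> *\<^sub>R b i" if "t \<in> I" for t i
      unfolding N P using poly_generator_eigenvector [OF flow_eigenvector [OF eigen that]] by blast
  qed
  have curv: "let v = frechet_derivative gram (at (X s)) (N (P t1) ** X s);
              w = frechet_derivative gram (at (X s)) (N (P t2) ** X s)
          in v \<noteq> w \<and> independent {v, w} \<longrightarrow>
             riemannian_quotient.sectional_curvature (gram_domain :: (real^'d^'n) set) gram
               (gram (X s)) (span {v, w}) = 0" if "s \<in> I" "t1 \<in> I" "t2 \<in> I" for s t1 t2
    unfolding FD_gram Let_def
    using sectional_curvature_commuting [OF dom [OF that(1)] Nsym Nsym Ncomm [OF that(2,3)] refl refl] by blast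
  have spec: "(\<exists>f :: real poly. \<forall>t\<in>I. (lam \<iota> has_real_derivative poly f (lam \<iota> t)) (at t within I))
      \<and> (\<not> lam \<iota> constant_on I \<longrightarrow> monotone_on I (<) (<) (lam \<iota>) \<or> monotone_on I (<) (>) (lam \<iota>))"
    if \<iota>: "\<iota> \<in> {1..CARD('d)}" for \<iota>
  proof -
    let ?\<mu> = "flow_eigenvalue X b (rev ks ! (\<iota> - 1))" and ?f = "smult 2 (pCons 0 (generator_poly K \<alpha>))"
    have eq: "lam \<iota> t = ?\<mu> t" if "t \<in> I" for t
      using flow_nonzero_eigenvalue [OF eigen ks _ _ that] \<iota> by (simp add: lam P len)
    have D: "(lam \<iota> has_real_derivative poly ?f (lam \<iota> t)) (at t within I)" if t: "t \<in> I" for t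
    proof -
      have "(?\<mu> has_real_derivative poly ?f (lam \<iota> t)) (at t within I)"
        unfolding eq [OF t] by (rule flow_eigenvalue_has_derivative [OF eigen t])
      then show ?thesis
        by (rule has_field_derivative_transform_within [OF _ zero_less_one t]) (simp add: eq)
    qed
    then show ?thesis using scalar_ode_monotone [OF I D] by blast
  qed
  have loop: "P constant_on I" if "t0 \<in> I" "t1 \<in> I" "t0 \<noteq> t1" "P t0 = P t1" for t0 t1
    using flow_no_loop [OF eigen that(1-3)] that(4) by (simp add: P constant_on_def)
  show ?thesis using Ncomm diag curv spec loop by blast
qed

end
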